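(* Let $\mathcal{A}$ be a cellular automaton with alphabet $Q$ and $\mu$ a shift-invariant Borel probability measure on $Q^{\mathbb{Z}}$. Then: (i) if $\mu$ is computable, $L_\mu(\mathcal{A})$ is a $\Sigma_3^0$ set; (ii) if $\mu$ is shift-ergodic with full support and $\mathcal{A}$ has an equicontinuity point, then $L_\mu(\mathcal{A})$ is recursively enumerable.
   Context: A CA $\mathcal{A}$ over finite alphabet $Q$ has radius $r$ and local rule $\delta:Q^{2r+1}\to Q$, global map $\mathcal{A}(c)_z=\delta(c_{z-r},\dots,c_{z+r})$. With $[u]_0=\{c:c_{[0,|u|-1]}=u\}$ and $\mathcal{A}^t\mu([u]_0)=\mu(\mathcal{A}^{-t}([u]_0))$, $L_\mu(\mathcal{A})=\{u\in Q^*:\mathcal{A}^t\mu([u]_0)\not\to0\}$. $\mu$ is computable if there is a computable $f:Q^*\times\mathbb{Q}\to\mathbb{Q}$ with $|\mu([u]_0)-f(u,\epsilon)|\le\epsilon$ for all $u$ and rational $\epsilon>0$. $\mu$ is shift-ergodic if every shift-invariant measurable set has measure 0 or 1; full support means $\mu([u]_0)>0$ for every word $u$. An equicontinuity point is a configuration $x$ such that for every $\epsilon>0$ there is $\delta>0$ with $d(x,y)<\delta\Rightarrow d(\mathcal{A}^t x,\mathcal{A}^t y)<\epsilon$ for all $t$ (product topology metric on $Q^{\mathbb{Z}}$). *)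

theory Defs
  imports "HOL-Probability.Probability" "HOL-Library.Nat_Bijection"
begin

section \<open>Partial recursive functions (Kleene), arity-free presentation\<close>

datatype recf = Z | S | Id nat | Cn recf "recf list" | Pr recf recf | Mn recf

inductive reval :: "recf \<Rightarrow> nat list \<Rightarrow> nat \<Rightarrow> bool" where
  reval_Z: "reval Z xs 0"
| reval_S: "reval S (x # xs) (Suc x)"
| reval_Id: "i < length xs \<Longrightarrow> reval (Id i) xs (xs ! i)"
| reval_Cn: "length ys = length gs \<Longrightarrow> (\<forall>i<length gs. reval (gs ! i) xs (ys ! i))
     \<Longrightarrow> reval f ys z \<Longrightarrow> reval (Cn f gs) xs z"
| reval_Pr0: "reval f xs y \<Longrightarrow> reval (Pr f g) (0 # xs) y"
| reval_PrS: "reval (Pr f g) (n # xs) y \<Longrightarrow> reval g (n # y # xs) z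
     \<Longrightarrow> reval (Pr f g) (Suc n # xs) z"
| reval_Mn: "reval f (n # xs) 0 \<Longrightarrow> (\<forall>m<n. \<exists>y. reval f (m # xs) (Suc y))
     \<Longrightarrow> reval (Mn f) xs n"

definition computable_fun :: "nat \<Rightarrow> (nat list \<Rightarrow> nat) \<Rightarrow> bool" where
  "computable_fun k f \<longleftrightarrow> (\<exists>e. \<forall>xs. length xs = k \<longrightarrow> reval e xs (f xs))"

definition decidable_rel :: "nat \<Rightarrow> (nat list \<Rightarrow> bool) \<Rightarrow> bool" where
  "decidable_rel k R \<longleftrightarrow> computable_fun k (\<lambda>xs. if R xs then 1 else 0)"

definition rec_enum :: "nat set \<Rightarrow> bool" where
  "rec_enum A \<longleftrightarrow> (\<exists>R. decidable_rel 2 R \<and> A = {x. \<exists>a. R [x, a]})"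

definition Sigma3 :: "nat set \<Rightarrow> bool" where
  "Sigma3 A \<longleftrightarrow> (\<exists>R. decidable_rel 4 R \<and> A = {x. \<exists>a. \<forall>b. \<exists>c. R [x, a, b, c]})"

definition rat_decode :: "nat \<Rightarrow> rat" where
  "rat_decode n = (case prod_decode n of (a, b) \<Rightarrow> of_int (int_decode a) / of_nat b)"

definition word_code :: "('q \<Rightarrow> nat) \<Rightarrow> 'q list \<Rightarrow> nat" where
  "word_code enc u = list_encode (map enc u)"

definition ca_global :: "nat \<Rightarrow> ('q list \<Rightarrow> 'q) \<Rightarrow> (int \<Rightarrow> 'q) \<Rightarrow> (int \<Rightarrow> 'q)" where
  "ca_global r \<delta> c = (\<lambda>z. \<delta> (map (\<lambda>i. c (z + i)) [- int r .. int r]))"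

definition shift :: "(int \<Rightarrow> 'q) \<Rightarrow> (int \<Rightarrow> 'q)" where
  "shift c = (\<lambda>z. c (z + 1))"

definition cyl :: "'q list \<Rightarrow> (int \<Rightarrow> 'q) set" where
  "cyl u = {c. \<forall>i<length u. c (int i) = u ! i}"

definition conf_space :: "(int \<Rightarrow> 'q) measure" where
  "conf_space = PiM UNIV (\<lambda>_. count_space UNIV)"

definition shift_invariant :: "(int \<Rightarrow> 'q) measure \<Rightarrow> bool" where
  "shift_invariant \<mu> \<longleftrightarrow> (\<forall>A\<in>sets \<mu>. measure \<mu> (shift -` A) = measure \<mu> A)"

definition shift_ergodic :: "(int \<Rightarrow> 'q) measure \<Rightarrow> bool" where
  "shift_ergodic \<mu> \<longleftrightarrow> (\<forall>A\<in>sets \<mu>. shift -` A = A \<longrightarrow> measure \<mu> A = 0 \<or> measure \<mu> A = 1)"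

definition full_support :: "(int \<Rightarrow> 'q) measure \<Rightarrow> bool" where
  "full_support \<mu> \<longleftrightarrow> (\<forall>u. measure \<mu> (cyl u) > 0)"

definition computable_measure :: "('q \<Rightarrow> nat) \<Rightarrow> (int \<Rightarrow> 'q) measure \<Rightarrow> bool" where
  "computable_measure enc \<mu> \<longleftrightarrow> (\<exists>f. computable_fun 2 f \<and>
     (\<forall>u e. rat_decode e > 0 \<longrightarrow>
        \<bar>measure \<mu> (cyl u) - real_of_rat (rat_decode (f [word_code enc u, e]))\<bar>
          \<le> real_of_rat (rat_decode e)))"

definition limit_lang :: "nat \<Rightarrow> ('q list \<Rightarrow> 'q) \<Rightarrow> (int \<Rightarrow> 'q) measure \<Rightarrow> 'q list set" where
  "limit_lang r \<delta> \<mu> = {u. \<not> ((\<lambda>t. measure \<mu> ((ca_global r \<delta> ^^ t) -` cyl u)) \<longlonglongrightarrow> 0)}"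

text \<open>Standard Cantor metric on configurations (induces the product topology).\<close>
definition cantor_dist :: "(int \<Rightarrow> 'q) \<Rightarrow> (int \<Rightarrow> 'q) \<Rightarrow> real" where
  "cantor_dist x y = (if x = y then 0
     else 2 powr (- real (LEAST n. \<exists>i. \<bar>i\<bar> = int n \<and> x i \<noteq> y i)))"

definition equicont_point :: "nat \<Rightarrow> ('q list \<Rightarrow> 'q) \<Rightarrow> (int \<Rightarrow> 'q) \<Rightarrow> bool" where
  "equicont_point r \<delta> x \<longleftrightarrow> (\<forall>\<epsilon>>0. \<exists>d>0. \<forall>y. cantor_dist x y < d \<longrightarrow>
     (\<forall>t. cantor_dist ((ca_global r \<delta> ^^ t) x) ((ca_global r \<delta> ^^ t) y) < \<epsilon>))"

end

theory Submission
  imports Defs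
begin

text \<open>
  For the first part, shift invariance writes $\mathcal{A}^t\mu([u]_0)$ as a finite sum of measures
  of cylinders, so it is computable to any precision, and $u \in L_\mu(\mathcal{A})$ says that for
  some $a$ it exceeds $1/(a+1)$ at arbitrarily late times $t$.

  For the second part, an equicontinuity point provides a word $w$ whose occurrences cannot be crossed
  by information, so the evolution between two occurrences of $w$ depends only on the cells around
  and between them. By ergodicity and full support, occurrences of $w$ surround a given window within
  a bounded distance with probability arbitrarily close to $1$. Hence $u \in L_\mu(\mathcal{A})$ iff
  $u$ occurs in $\mathcal{A}^t(y)$ for some spatially periodic $y$ containing $w$ and some $t \ge q^p$,
  where $p$ is the period of $y$: such a $t$ lies in the eventual time cycle of $y$, so that $u$ then
  occurs at infinitely many times, for all configurations of a cylinder of positive measure.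
\<close>

section \<open>Closure properties of total computable functions\<close>

text \<open>The number of cylinders in the preimage of [u] may grow like q^(2rt), so no fixed
  precision per cylinder would do: it is scaled by that number, and the test at each time stays a
  comparison of two integers. Approximants cannot decide whether a measure reaches a given bound,
  but membership only asks for some positive bound that is reached again and again, so a gap between
  two thresholds may absorb the error. In the second part the order of choices matters: the period p
  depends on u and on the probability to be caught, but not on the time, so a late time t >= q^p at
  which u still has that probability can be picked afterwards. The word w is not computed from the
  automaton; being fixed, it enters the decidable relation as a constant. Words, light cones and
  stretches of periodic configurations are all kept as single base-q numerals, so that the
  computability proofs reduce to arithmetic with natural numbers. Negative cells would spoil this,
  hence the passage to a one-sided neighbourhood.\<close>

lemma computable_fun_cong:
  assumes "computable_fun k f" "\<And>xs. length xs = k \<Longrightarrow> f xs = g xs"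
  shows "computable_fun k g"
  using assms unfolding computable_fun_def by metis

lemma computable_compose:
  assumes f: "computable_fun (length gs) f"
    and gs: "\<And>g. g \<in> set gs \<Longrightarrow> computable_fun k g"
  shows "computable_fun k (\<lambda>xs. f (map (\<lambda>g. g xs) gs))"
proof -
  obtain e where e: "\<And>xs. length xs = length gs \<Longrightarrow> reval e xs (f xs)"
    using f unfolding computable_fun_def by blast
  have "\<forall>g\<in>set gs. \<exists>d. \<forall>xs. length xs = k \<longrightarrow> reval d xs (g xs)"
    using gs unfolding computable_fun_def by blast
  then obtain D where D: "\<And>g xs. g \<in> set gs \<Longrightarrow> length xs = k \<Longrightarrow> reval (D g) xs (g xs)"
    by metis
  have "reval (Cn e (map D gs)) xs (f (map (\<lambda>g. g xs) gs))" if "length xs = k" for xs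
    by (rule reval_Cn[where ys = "map (\<lambda>g. g xs) gs"]) (use that D e in auto)
  then show ?thesis unfolding computable_fun_def by blast
qed

lemma computable_nth: "i < k \<Longrightarrow> computable_fun k (\<lambda>xs. xs ! i)"
  unfolding computable_fun_def by (metis reval_Id)

lemma computable_hd: "0 < k \<Longrightarrow> computable_fun k (\<lambda>xs. hd xs)"
  by (rule computable_fun_cong[OF computable_nth[of 0]]) (auto simp: hd_conv_nth)

lemma computable_nth_tl: "Suc i < k \<Longrightarrow> computable_fun k (\<lambda>xs. tl xs ! i)"
  by (rule computable_fun_cong[OF computable_nth[of "Suc i"]]) (auto simp: nth_tl)

lemma computable_hd_tl: "Suc 0 < k \<Longrightarrow> computable_fun k (\<lambda>xs. hd (tl xs))"
proof (rule computable_fun_cong[OF computable_nth[of "Suc 0"]])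
  fix xs :: "nat list" assume "Suc 0 < k" "length xs = k"
  then show "xs ! Suc 0 = hd (tl xs)"
    by (cases xs; cases "tl xs") auto
qed simp

lemma computable_nth_tl_tl: "Suc (Suc i) < k \<Longrightarrow> computable_fun k (\<lambda>xs. tl (tl xs) ! i)"
  by (rule computable_fun_cong[OF computable_nth[of "Suc (Suc i)"]]) (auto simp: nth_tl)

lemma computable_comp1:
  assumes "computable_fun 1 (\<lambda>xs. F (xs ! 0))" "computable_fun k f"
  shows "computable_fun k (\<lambda>xs. F (f xs))"
  using computable_compose[of "[f]" "\<lambda>xs. F (xs ! 0)" k] assms by simp

lemma computable_comp2:
  assumes "computable_fun 2 (\<lambda>xs. F (xs ! 0) (xs ! 1))" "computable_fun k f" "computable_fun k g"
  shows "computable_fun k (\<lambda>xs. F (f xs) (g xs))"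
  using computable_compose[of "[f, g]" "\<lambda>xs. F (xs ! 0) (xs ! 1)" k] assms
  by (auto simp: numeral_2_eq_2)

lemma computable_comp3:
  assumes "computable_fun 3 (\<lambda>xs. F (xs ! 0) (xs ! 1) (xs ! 2))"
    "computable_fun k f" "computable_fun k g" "computable_fun k h"
  shows "computable_fun k (\<lambda>xs. F (f xs) (g xs) (h xs))"
  using computable_compose[of "[f, g, h]" "\<lambda>xs. F (xs ! 0) (xs ! 1) (xs ! 2)" k] assms
  by (auto simp: numeral_3_eq_3)

lemma computable_comp4:
  assumes "computable_fun 4 (\<lambda>xs. F (xs ! 0) (xs ! 1) (xs ! 2) (xs ! 3))"
    "computable_fun k f" "computable_fun k g" "computable_fun k h" "computable_fun k h'"
  shows "computable_fun k (\<lambda>xs. F (f xs) (g xs) (h xs) (h' xs))"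
  using computable_compose[of "[f, g, h, h']" "\<lambda>xs. F (xs ! 0) (xs ! 1) (xs ! 2) (xs ! 3)" k] assms
  by (auto simp: eval_nat_numeral)

lemma computable_comp_list2:
  assumes "computable_fun 2 F" "computable_fun k f" "computable_fun k g"
  shows "computable_fun k (\<lambda>xs. F [f xs, g xs])"
  using computable_compose[of "[f, g]" F k] assms by (auto simp: numeral_2_eq_2)

lemma computable_Suc: "computable_fun k f \<Longrightarrow> computable_fun k (\<lambda>xs. Suc (f xs))"
proof (rule computable_comp1[where F = Suc])
  have "reval S xs (Suc (xs ! 0))" if "length xs = 1" for xs
    using that by (cases xs) (auto intro: reval_S)
  then show "computable_fun 1 (\<lambda>xs. Suc (xs ! 0))"
    unfolding computable_fun_def by blast
qed

lemma computable_const: "computable_fun k (\<lambda>xs. c)"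
proof (induction c)
  case 0
  show ?case unfolding computable_fun_def using reval_Z by blast
qed (rule computable_Suc)

text \<open>\<open>Pr\<close> recurses on the head of the argument list. Composing it with
  \<open>b\<close> and all projections puts a computed bound in front of the unchanged
  parameters.\<close>

lemma computable_rec:
  assumes f: "computable_fun k f"
    and g: "computable_fun (Suc (Suc k)) (\<lambda>ys. g (hd ys) (hd (tl ys)) (tl (tl ys)))"
    and b: "computable_fun k b"
  shows "computable_fun k (\<lambda>xs. rec_nat (f xs) (\<lambda>n y. g n y xs) (b xs))"
proof -
  obtain e where e: "\<And>xs. length xs = k \<Longrightarrow> reval e xs (f xs)"
    using f unfolding computable_fun_def by blast
  obtain d where d: "\<And>n y xs. length xs = k \<Longrightarrow> reval d (n # y # xs) (g n y xs)"
    using g unfolding computable_fun_def by (metis length_Cons list.sel(1,3))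
  define h where "h ys = rec_nat (f (tl ys)) (\<lambda>n y. g n y (tl ys)) (hd ys)" for ys
  have "reval (Pr e d) (n # xs) (rec_nat (f xs) (\<lambda>n y. g n y xs) n)" if "length xs = k" for n xs
    by (induction n) (use that e d in \<open>auto intro: reval_Pr0 reval_PrS\<close>)
  then have "reval (Pr e d) ys (h ys)" if "length ys = Suc k" for ys
    using that by (cases ys) (auto simp: h_def)
  then have h: "computable_fun (length (b # map (\<lambda>i xs. xs ! i) [0..<k])) h"
    unfolding computable_fun_def by auto
  have "computable_fun k (\<lambda>xs. h (map (\<lambda>g. g xs) (b # map (\<lambda>i xs. xs ! i) [0..<k])))"
    by (rule computable_compose[OF h]) (use b in \<open>auto intro: computable_nth\<close>)
  then show ?thesis
    by (rule computable_fun_cong) (auto simp: h_def comp_def map_nth)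
qed

lemmas computable_basic = computable_nth computable_hd computable_nth_tl computable_hd_tl
  computable_nth_tl_tl computable_Suc computable_const

section \<open>Arithmetic, decidable comparisons, pairing and iteration\<close>

lemma computable_add:
  assumes "computable_fun k f" "computable_fun k g"
  shows "computable_fun k (\<lambda>xs. f xs + g xs)"
proof (rule computable_comp2[OF _ assms])
  have *: "rec_nat a (\<lambda>_ y. Suc y) b = a + b" for a b :: nat
    by (induction b) auto
  have "computable_fun 2 (\<lambda>xs. rec_nat (xs ! 0) (\<lambda>_ y. Suc y) (xs ! 1))"
    by (intro computable_rec computable_basic) auto
  then show "computable_fun 2 (\<lambda>xs. xs ! 0 + xs ! 1)" by (simp add: *)
qed

lemma computable_mult:
  assumes "computable_fun k f" "computable_fun k g"
  shows "computable_fun k (\<lambda>xs. f xs * g xs)"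
proof (rule computable_comp2[OF _ assms])
  have *: "rec_nat 0 (\<lambda>_ y. a + y) b = a * b" for a b :: nat
    by (induction b) auto
  have "computable_fun 2 (\<lambda>xs. rec_nat 0 (\<lambda>_ y. xs ! 0 + y) (xs ! 1))"
    by (intro computable_rec computable_add computable_basic) auto
  then show "computable_fun 2 (\<lambda>xs. xs ! 0 * xs ! 1)" by (simp add: *)
qed

lemma computable_power:
  assumes "computable_fun k f" "computable_fun k g"
  shows "computable_fun k (\<lambda>xs. f xs ^ g xs)"
proof (rule computable_comp2[OF _ assms])
  have *: "rec_nat 1 (\<lambda>_ y. a * y) b = a ^ b" for a b :: nat
    by (induction b) auto
  have "computable_fun 2 (\<lambda>xs. rec_nat 1 (\<lambda>_ y. xs ! 0 * y) (xs ! 1))"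
    by (intro computable_rec computable_mult computable_basic) auto
  then show "computable_fun 2 (\<lambda>xs. xs ! 0 ^ xs ! 1)" by (simp only: *)
qed

lemma computable_diff:
  assumes "computable_fun k f" "computable_fun k g"
  shows "computable_fun k (\<lambda>xs. f xs - g xs)"
proof (rule computable_comp2[OF _ assms])
  have pred: "rec_nat 0 (\<lambda>n _. n) a = a - 1" for a :: nat
    by (cases a) auto
  have "computable_fun 1 (\<lambda>xs. rec_nat 0 (\<lambda>n _. n) (xs ! 0))"
    by (intro computable_rec computable_basic) auto
  then have pred1: "computable_fun 1 (\<lambda>xs. xs ! 0 - 1)" by (simp only: pred)
  have *: "rec_nat a (\<lambda>_ y. y - 1) b = a - b" for a b :: nat
    by (induction b) auto
  have "computable_fun 2 (\<lambda>xs. rec_nat (xs ! 0) (\<lambda>_ y. y - 1) (xs ! 1))"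
    by (intro computable_rec computable_comp1[OF pred1] computable_basic) auto
  then show "computable_fun 2 (\<lambda>xs. xs ! 0 - xs ! 1)" by (simp only: *)
qed

lemma computable_sum:
  assumes "computable_fun (Suc k) (\<lambda>ys. F (hd ys) (tl ys))" "computable_fun k b"
  shows "computable_fun k (\<lambda>xs. \<Sum>i<b xs. F i xs)"
proof -
  have *: "rec_nat 0 (\<lambda>n y. y + F n xs) m = (\<Sum>i<m. F i xs)" for xs m
    by (induction m) auto
  \<comment> \<open>Inside the recursion the arguments are \<open>n # y # xs\<close>; these
    projections delete the accumulator \<open>y\<close>, so that the summand sees
    \<open>n # xs\<close>.\<close>
  let ?gs = "(\<lambda>ys. hd ys) # map (\<lambda>i ys. ys ! Suc (Suc i)) [0..<k]"
  have gs: "computable_fun (length ?gs) (\<lambda>ys. F (hd ys) (tl ys))"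
    using assms(1) by simp
  have "computable_fun (Suc (Suc k)) (\<lambda>ys. (\<lambda>ys. F (hd ys) (tl ys)) (map (\<lambda>g. g ys) ?gs))"
    by (rule computable_compose[OF gs]) (auto intro: computable_nth computable_hd)
  then have "computable_fun (Suc (Suc k)) (\<lambda>ys. F (hd ys) (tl (tl ys)))"
  proof (rule computable_fun_cong)
    fix ys :: "nat list" assume "length ys = Suc (Suc k)"
    then have "map (\<lambda>i. ys ! Suc (Suc i)) [0..<k] = tl (tl ys)"
      by (intro nth_equalityI) (auto simp: nth_tl)
    then show "(\<lambda>ys. F (hd ys) (tl ys)) (map (\<lambda>g. g ys) ?gs) = F (hd ys) (tl (tl ys))"
      by (simp add: comp_def)
  qed
  then have "computable_fun k (\<lambda>xs. rec_nat 0 (\<lambda>n y. y + F n xs) (b xs))"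
    by (intro computable_rec computable_add assms(2) computable_basic) auto
  then show ?thesis by (simp only: *)
qed

lemma decidable_less:
  assumes "computable_fun k f" "computable_fun k g"
  shows "decidable_rel k (\<lambda>xs. f xs < g xs)"
proof -
  \<comment> \<open>Subtraction is truncated, so this is the sign of the difference: 1 if it is
    positive and 0 otherwise.\<close>
  have "computable_fun k (\<lambda>xs. 1 - (1 - (g xs - f xs)))"
    by (intro computable_diff assms computable_basic)
  then show ?thesis unfolding decidable_rel_def
    by (rule computable_fun_cong) auto
qed

lemma decidable_not:
  assumes "decidable_rel k P"
  shows "decidable_rel k (\<lambda>xs. \<not> P xs)"
proof -
  have "computable_fun k (\<lambda>xs. 1 - (if P xs then 1 else 0))"
    by (intro computable_diff assms[unfolded decidable_rel_def] computable_basic)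
  then show ?thesis unfolding decidable_rel_def
    by (rule computable_fun_cong) auto
qed

lemma decidable_le:
  assumes "computable_fun k f" "computable_fun k g"
  shows "decidable_rel k (\<lambda>xs. f xs \<le> g xs)"
  using decidable_not[OF decidable_less[OF assms(2,1)]] by (simp add: not_less)

lemma decidable_conj:
  assumes "decidable_rel k P" "decidable_rel k Q"
  shows "decidable_rel k (\<lambda>xs. P xs \<and> Q xs)"
proof -
  have "computable_fun k (\<lambda>xs. (if P xs then 1 else 0) * (if Q xs then 1 else 0))"
    by (intro computable_mult assms[unfolded decidable_rel_def])
  then show ?thesis unfolding decidable_rel_def
    by (rule computable_fun_cong) auto
qed

lemma decidable_eq:
  assumes "computable_fun k f" "computable_fun k g"
  shows "decidable_rel k (\<lambda>xs. f xs = g xs)"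
  using decidable_conj[OF decidable_le[OF assms] decidable_le[OF assms(2,1)]]
  by (simp add: eq_iff)

lemma computable_if:
  assumes "decidable_rel k P" "computable_fun k f" "computable_fun k g"
  shows "computable_fun k (\<lambda>xs. if P xs then f xs else g xs)"
proof -
  have "computable_fun k (\<lambda>xs. (if P xs then 1 else 0) * f xs + (1 - (if P xs then 1 else 0)) * g xs)"
    by (intro computable_mult computable_add computable_diff computable_basic assms
          assms(1)[unfolded decidable_rel_def])
  then show ?thesis by (rule computable_fun_cong) auto
qed

lemmas computable_arith = computable_basic computable_add computable_mult computable_power
  computable_diff computable_sum computable_if decidable_less decidable_le decidable_not
  decidable_conj decidable_eq

text \<open>The quotient counts the positive multiples of the divisor up to the dividend; the guard
  \<open>0 < b\<close> reproduces the convention that division by 0 gives 0.\<close>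

lemma computable_div:
  assumes "computable_fun k f" "computable_fun k g"
  shows "computable_fun k (\<lambda>xs. f xs div g xs)"
proof (rule computable_comp2[OF _ assms])
  have *: "(\<Sum>i<a. if 0 < b \<and> Suc i * b \<le> a then 1 else 0) = a div b" for a b :: nat
  proof (cases "b = 0")
    case False
    have "{i. i < a \<and> Suc i * b \<le> a} = {..<a div b}"
    proof -
      have "Suc i * b \<le> a \<longleftrightarrow> i < a div b" for i
        using less_eq_div_iff_mult_less_eq[of b "Suc i" a] False unfolding Suc_le_eq by blast
      moreover have "i < a div b \<Longrightarrow> i < a" for i
        using div_le_dividend[of a b] by linarith
      ultimately show ?thesis by blast
    qed
    moreover have "(\<Sum>i<a. if 0 < b \<and> Suc i * b \<le> a then 1 else 0) = card {i. i < a \<and> Suc i * b \<le> a}"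
    proof -
      have "(\<Sum>i<a. if 0 < b \<and> Suc i * b \<le> a then 1 else 0) =
          (\<Sum>i\<in>{..<a}. if Suc i * b \<le> a then 1 else (0::nat))"
        using False by (intro sum.cong) auto
      also have "\<dots> = card {i \<in> {..<a}. Suc i * b \<le> a}"
        unfolding card_eq_sum by (rule sum.inter_filter[symmetric]) simp
      finally show ?thesis by (simp only: lessThan_iff)
    qed
    ultimately show ?thesis by simp
  qed auto
  have "computable_fun 2 (\<lambda>xs. \<Sum>i<xs ! 0. if 0 < xs ! 1 \<and> Suc i * xs ! 1 \<le> xs ! 0 then 1 else 0)"
    by (intro computable_arith) auto
  then show "computable_fun 2 (\<lambda>xs. xs ! 0 div xs ! 1)" by (simp only: *)
qed

lemma computable_mod:
  assumes "computable_fun k f" "computable_fun k g"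
  shows "computable_fun k (\<lambda>xs. f xs mod g xs)"
proof -
  have "computable_fun k (\<lambda>xs. f xs - f xs div g xs * g xs)"
    by (intro computable_arith computable_div assms)
  then show ?thesis by (simp add: minus_div_mult_eq_mod)
qed

lemma computable_prod_encode:
  assumes "computable_fun k f" "computable_fun k g"
  shows "computable_fun k (\<lambda>xs. prod_encode (f xs, g xs))"
  unfolding prod_encode_def triangle_def split
  by (intro computable_arith computable_div assms)

text \<open>Both components of a pair are at most its code, so decoding is a bounded search; exactly
  one pair matches, and the sum returns its component.\<close>

lemma computable_prod_decode_fst:
  assumes "computable_fun k f"
  shows "computable_fun k (\<lambda>xs. fst (prod_decode (f xs)))"
proof (rule computable_comp1[OF _ assms])
  have *: "(\<Sum>a<Suc z. \<Sum>b<Suc z. if prod_encode (a, b) = z then a else 0) = fst (prod_decode z)" for z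
  proof -
    obtain a b where ab: "prod_decode z = (a, b)" by fastforce
    then have z: "z = prod_encode (a, b)" by (metis prod_decode_inverse)
    have "(\<Sum>a'<Suc z. \<Sum>b'<Suc z. if prod_encode (a', b') = z then a' else 0) =
        (\<Sum>a'<Suc z. \<Sum>b'<Suc z. if b = b' then (if a = a' then a' else 0) else 0)"
      unfolding z prod_encode_eq by (intro sum.cong refl) auto
    also have "\<dots> = a"
      using le_prod_encode_1[of a b] le_prod_encode_2[of b a] z
      by (simp add: less_Suc_eq_le del: sum.lessThan_Suc)
    finally show ?thesis by (simp add: ab)
  qed
  have "computable_fun 1 (\<lambda>xs. \<Sum>a<Suc (xs ! 0). \<Sum>b<Suc (xs ! 0).
      if prod_encode (a, b) = xs ! 0 then a else 0)"
    by (intro computable_arith computable_prod_encode) auto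
  then show "computable_fun 1 (\<lambda>xs. fst (prod_decode (xs ! 0)))" by (simp only: *)
qed

lemma computable_prod_decode_snd:
  assumes "computable_fun k f"
  shows "computable_fun k (\<lambda>xs. snd (prod_decode (f xs)))"
proof (rule computable_comp1[OF _ assms])
  have *: "(\<Sum>b<Suc z. if prod_encode (fst (prod_decode z), b) = z then b else 0) = snd (prod_decode z)" for z
  proof -
    obtain a b where ab: "prod_decode z = (a, b)" by fastforce
    then have z: "z = prod_encode (a, b)" by (metis prod_decode_inverse)
    have "(\<Sum>b'<Suc z. if prod_encode (a, b') = z then b' else 0) = (\<Sum>b'<Suc z. if b = b' then b' else 0)"
      unfolding z prod_encode_eq by (intro sum.cong refl) auto
    also have "\<dots> = b"
      using le_prod_encode_2[of b a] z by (simp add: less_Suc_eq_le del: sum.lessThan_Suc)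
    finally show ?thesis by (simp add: ab)
  qed
  have "computable_fun 1 (\<lambda>xs. \<Sum>b<Suc (xs ! 0).
      if prod_encode (fst (prod_decode (xs ! 0)), b) = xs ! 0 then b else 0)"
    by (intro computable_arith computable_prod_encode computable_prod_decode_fst) auto
  then show "computable_fun 1 (\<lambda>xs. snd (prod_decode (xs ! 0)))" by (simp only: *)
qed

text \<open>Iterated pairing lets one number carry several existential witnesses, as the single
  quantifiers of \<open>rec_enum\<close> and \<open>Sigma3\<close> require.\<close>

fun component :: "nat \<Rightarrow> nat \<Rightarrow> nat" where
  "component 0 a = fst (prod_decode a)"
| "component (Suc j) a = component j (snd (prod_decode a))"

lemma ex_components: "\<exists>a. \<forall>j<length vs. component j a = vs ! j"
proof (induction vs)
  case (Cons v vs)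
  then obtain a where "\<forall>j<length vs. component j a = vs ! j" by blast
  then have "\<forall>j<length (v # vs). component j (prod_encode (v, a)) = (v # vs) ! j"
    by (auto simp: less_Suc_eq_0_disj)
  then show ?case by blast
qed simp

lemma computable_component:
  "computable_fun k f \<Longrightarrow> computable_fun k (\<lambda>xs. component j (f xs))"
  by (induction j arbitrary: f) (simp_all add: computable_prod_decode_fst computable_prod_decode_snd)

text \<open>A function with finite support is computable however it is given. This is how an
  arbitrary local rule enters the computations.\<close>

lemma computable_table:
  assumes "\<And>x. B \<le> x \<Longrightarrow> T x = 0" and f: "computable_fun k f"
  shows "computable_fun k (\<lambda>xs. T (f xs))"
proof -
  have "computable_fun k (\<lambda>xs. \<Sum>j<B. if f xs = j then T j else 0)"
  proof (induction B)
    case (Suc B)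
    then show ?case unfolding sum.lessThan_Suc
      by (intro computable_add computable_if decidable_eq f computable_const)
  qed (simp add: computable_const)
  then show ?thesis
    by (rule computable_fun_cong) (use assms(1) in \<open>auto simp: not_less\<close>)
qed

lemma computable_funpow:
  assumes g: "computable_fun (Suc k) (\<lambda>ys. g (hd ys) (tl ys))"
    and "computable_fun k n" "computable_fun k f"
  shows "computable_fun k (\<lambda>xs. ((\<lambda>y. g y xs) ^^ n xs) (f xs))"
proof -
  have *: "rec_nat a (\<lambda>_ y. g y xs) m = ((\<lambda>y. g y xs) ^^ m) a" for a xs m
    by (induction m) auto
  let ?gs = "(\<lambda>ys. hd (tl ys)) # map (\<lambda>i ys. ys ! Suc (Suc i)) [0..<k]"
  have gs: "computable_fun (length ?gs) (\<lambda>ys. g (hd ys) (tl ys))"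
    using g by simp
  have "computable_fun (Suc (Suc k)) (\<lambda>ys. (\<lambda>ys. g (hd ys) (tl ys)) (map (\<lambda>h. h ys) ?gs))"
    by (rule computable_compose[OF gs]) (auto intro: computable_nth computable_hd_tl)
  then have "computable_fun (Suc (Suc k)) (\<lambda>ys. g (hd (tl ys)) (tl (tl ys)))"
  proof (rule computable_fun_cong)
    fix ys :: "nat list" assume "length ys = Suc (Suc k)"
    then have "map (\<lambda>i. ys ! Suc (Suc i)) [0..<k] = tl (tl ys)"
      by (intro nth_equalityI) (auto simp: nth_tl)
    then show "(\<lambda>ys. g (hd ys) (tl ys)) (map (\<lambda>g. g ys) ?gs) = g (hd (tl ys)) (tl (tl ys))"
      by (simp add: comp_def)
  qed
  then have "computable_fun k (\<lambda>xs. rec_nat (f xs) (\<lambda>n y. g y xs) (n xs))"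
    by (intro computable_rec assms)
  then show ?thesis by (simp only: *)
qed

section \<open>Words as base-$q$ numerals\<close>

definition dig :: "nat \<Rightarrow> nat \<Rightarrow> nat \<Rightarrow> nat" where
  "dig q m i = m div q ^ i mod q"

lemma dig_less: "0 < q \<Longrightarrow> dig q m i < q"
  by (simp add: dig_def)

lemma digit_sum_less:
  fixes q :: nat
  assumes "\<And>i. a i < q"
  shows "(\<Sum>j<L. a j * q ^ j) < q ^ L"
proof (induction L)
  case (Suc L)
  have "(\<Sum>j<Suc L. a j * q ^ j) < q ^ L + a L * q ^ L" using Suc by simp
  also have "\<dots> = Suc (a L) * q ^ L" by simp
  also have "\<dots> \<le> q * q ^ L" using assms[of L] by (intro mult_right_mono) auto
  finally show ?case by simp
qed simp

lemma dig_sum: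
  assumes "\<And>i. a i < q" "i < L"
  shows "dig q (\<Sum>j<L. a j * q ^ j) i = a i"
  using assms(2)
proof (induction L)
  case (Suc L)
  have q: "0 < q" using assms(1)[of 0] by simp
  let ?S = "\<Sum>j<L. a j * q ^ j"
  have S: "?S < q ^ L" by (rule digit_sum_less) fact
  show ?case
  proof (cases "i = L")
    case True
    then show ?thesis using S q assms(1)[of L] by (simp add: dig_def)
  next
    case False
    then have i: "i < L" using Suc.prems by simp
    then obtain d where L: "L = i + Suc d" by (metis add_Suc_right less_imp_Suc_add)
    have "q ^ L = q ^ i * (q * q ^ d)" by (simp add: L power_add)
    then have eq: "(\<Sum>j<Suc L. a j * q ^ j) = ?S + q ^ i * (q * (a L * q ^ d))"
      by (simp add: algebra_simps)
    have "(\<Sum>j<Suc L. a j * q ^ j) div q ^ i = q * (a L * q ^ d) + ?S div q ^ i"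
      unfolding eq using q by (intro div_mult_self2) simp
    then show ?thesis using Suc.IH[OF i] by (simp add: dig_def)
  qed
qed simp

text \<open>Equality of two words of length \<open>n\<close> becomes one comparison of residues,
  which replaces a quantifier over positions in the decidable relations.\<close>

lemma mod_power_eq_iff_dig:
  assumes "0 < q"
  shows "a mod q ^ n = b mod q ^ n \<longleftrightarrow> (\<forall>i<n. dig q a i = dig q b i)"
proof (induction n)
  case (Suc n)
  have *: "c mod q ^ Suc n = q ^ n * dig q c n + c mod q ^ n" for c
    by (metis dig_def mod_mult2_eq power_Suc2)
  have "a mod q ^ Suc n = b mod q ^ Suc n \<longleftrightarrow> dig q a n = dig q b n \<and> a mod q ^ n = b mod q ^ n"
  proof
    assume eq: "a mod q ^ Suc n = b mod q ^ Suc n"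
    have "c mod q ^ Suc n div q ^ n = dig q c n \<and> c mod q ^ Suc n mod q ^ n = c mod q ^ n" for c
      unfolding * using assms by simp
    then show "dig q a n = dig q b n \<and> a mod q ^ n = b mod q ^ n" using eq by metis
  qed (simp only: *)
  then show ?case using Suc.IH less_Suc_eq by metis
qed simp

lemma dig_mod_power:
  assumes "0 < q" "i < n"
  shows "dig q (m mod q ^ n) i = dig q m i"
  using mod_power_eq_iff_dig[of q "m mod q ^ n" n m] assms by simp

lemma dig_div_power: "dig q (m div q ^ i) j = dig q m (i + j)"
  by (simp add: dig_def power_add div_mult2_eq)

lemma computable_dig:
  assumes "computable_fun k f" "computable_fun k g"
  shows "computable_fun k (\<lambda>xs. dig q (f xs) (g xs))"
  unfolding dig_def by (intro computable_arith computable_div computable_mod assms)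

definition digits_code :: "nat \<Rightarrow> nat \<Rightarrow> nat \<Rightarrow> nat" where
  "digits_code q n m = list_encode (map (dig q m) [0..<n])"

lemma computable_digits_code:
  assumes "computable_fun k f" "computable_fun k g"
  shows "computable_fun k (\<lambda>xs. digits_code q (f xs) (g xs))"
proof (rule computable_comp2[OF _ assms])
  \<comment> \<open>\<open>list_encode\<close> wraps the head around the code of the tail, so the
    recursion starts at the last digit and runs down.\<close>
  have *: "j \<le> n \<Longrightarrow> rec_nat 0 (\<lambda>j y. Suc (prod_encode (dig q m (n - Suc j), y))) j =
      list_encode (map (dig q m) [n - j..<n])" for n m j
  proof (induction j)
    case (Suc j)
    then have "[n - Suc j..<n] = (n - Suc j) # [n - j..<n]"
      by (subst upt_conv_Cons) (auto simp: Suc_diff_Suc)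
    then show ?case using Suc by simp
  qed simp
  have "computable_fun 2 (\<lambda>xs. rec_nat 0 (\<lambda>j y.
      Suc (prod_encode (dig q (xs ! 1) (xs ! 0 - Suc j), y))) (xs ! 0))"
    by (intro computable_rec computable_prod_encode computable_dig computable_arith) auto
  then show "computable_fun 2 (\<lambda>xs. digits_code q (xs ! 0) (xs ! 1))"
    by (simp only: * order_refl digits_code_def diff_self_eq_0)
qed

section \<open>Cellular automata on numerals\<close>

definition translate :: "int \<Rightarrow> (int \<Rightarrow> 'q) \<Rightarrow> (int \<Rightarrow> 'q)" where
  "translate k c = (\<lambda>z. c (z + k))"

lemma translate_translate: "translate k (translate l c) = translate (k + l) c"
  by (simp add: translate_def add_ac)

lemma translate_0 [simp]: "translate 0 c = c"
  by (simp add: translate_def)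

lemma ca_global_translate: "ca_global r \<delta> (translate k c) = translate k (ca_global r \<delta> c)"
  by (simp add: translate_def ca_global_def add_ac)

lemma ca_global_pow_translate:
  "(ca_global r \<delta> ^^ t) (translate k c) = translate k ((ca_global r \<delta> ^^ t) c)"
  by (induction t) (simp_all add: ca_global_translate)

text \<open>The automaton with neighbourhood $\{0,\dots,2r\}$, so that it acts on one-sided sequences.\<close>
definition ca_onesided :: "nat \<Rightarrow> ('q list \<Rightarrow> 'q) \<Rightarrow> (int \<Rightarrow> 'q) \<Rightarrow> (int \<Rightarrow> 'q)" where
  "ca_onesided r \<delta> c = (\<lambda>z. \<delta> (map (\<lambda>i. c (z + int i)) [0..<2 * r + 1]))"

lemma ca_onesided_eq_translate: "ca_onesided r \<delta> c = translate (int r) (ca_global r \<delta> c)"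
proof -
  have "[- int r..int r] = map (\<lambda>i. int i - int r) [0..<2 * r + 1]"
    by (rule nth_equalityI) (auto simp del: upt_Suc)
  then show ?thesis
    by (simp add: ca_onesided_def translate_def ca_global_def comp_def del: upt_Suc)
qed

lemma ca_onesided_pow:
  "(ca_onesided r \<delta> ^^ t) c = translate (int (r * t)) ((ca_global r \<delta> ^^ t) c)"
  by (induction t)
    (simp_all add: ca_onesided_eq_translate ca_global_translate translate_translate algebra_simps)

lemma ca_onesided_cong:
  assumes "\<And>i. i < 2 * r + 1 \<Longrightarrow> c (z + int i) = c' (z + int i)"
  shows "ca_onesided r \<delta> c z = ca_onesided r \<delta> c' z"
  unfolding ca_onesided_def using assms by (intro arg_cong[where f = \<delta>] map_cong) auto

text \<open>The light cone of \<open>z\<close> after \<open>t\<close> steps is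
  \<open>z..z + 2rt\<close>: each step adds \<open>2r\<close> cells on the right and none on the
  left.\<close>

lemma ca_onesided_pow_local:
  assumes "\<And>z. a \<le> z \<Longrightarrow> z < b \<Longrightarrow> c z = c' z" "a \<le> z" "z + int (2 * r * t) < b"
  shows "(ca_onesided r \<delta> ^^ t) c z = (ca_onesided r \<delta> ^^ t) c' z"
  using assms(2,3)
proof (induction t arbitrary: z)
  case 0
  then show ?case using assms(1) by simp
next
  case (Suc t)
  have "(ca_onesided r \<delta> ^^ t) c (z + int i) = (ca_onesided r \<delta> ^^ t) c' (z + int i)"
    if "i < 2 * r + 1" for i
    using Suc.prems that by (intro Suc.IH) (auto simp: algebra_simps)
  then show ?case using ca_onesided_cong[of r "(ca_onesided r \<delta> ^^ t) c" z] by simp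
qed

section \<open>Simulation of the automaton by integer arithmetic\<close>

locale coded_automaton =
  fixes r :: nat and \<delta> :: "'q::finite list \<Rightarrow> 'q" and enc :: "'q \<Rightarrow> nat" and q :: nat
  assumes card_eq: "q = CARD('q)" and enc: "bij_betw enc UNIV {..<q}"
begin

abbreviation F :: "(int \<Rightarrow> 'q) \<Rightarrow> (int \<Rightarrow> 'q)" where "F \<equiv> ca_global r \<delta>"

abbreviation G :: "(int \<Rightarrow> 'q) \<Rightarrow> (int \<Rightarrow> 'q)" where "G \<equiv> ca_onesided r \<delta>"

definition dec :: "nat \<Rightarrow> 'q" where "dec = inv enc"

lemma dec_enc [simp]: "dec (enc a) = a"
  using enc by (simp add: dec_def bij_betw_def)

lemma enc_dec: "i < q \<Longrightarrow> enc (dec i) = i"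
  using enc by (metis bij_betw_def dec_enc f_inv_into_f lessThan_iff dec_def)

lemma enc_less: "enc a < q"
  using enc by (auto simp: bij_betw_def)

lemma q_pos: "0 < q"
  by (simp add: card_eq)

text \<open>The numeral is carried by the cells \<open>z >= 0\<close>. Since \<open>nat\<close>
  sends negative cells to 0, these repeat the lowest digit; the one-sided automaton never reads them
  from a cell \<open>z >= 0\<close>.\<close>

definition conf :: "nat \<Rightarrow> int \<Rightarrow> 'q" where
  "conf m z = dec (dig q m (nat z))"

definition word :: "nat \<Rightarrow> nat \<Rightarrow> 'q list" where
  "word n m = map (\<lambda>i. dec (dig q m i)) [0..<n]"

lemma length_word [simp]: "length (word n m) = n"
  by (simp add: word_def)

lemma word_code_word: "word_code enc (word n m) = digits_code q n m"
  unfolding word_code_def digits_code_def word_def map_map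
  by (intro arg_cong[where f = list_encode] map_cong) (simp_all add: enc_dec dig_less[OF q_pos])

lemma word_code_inj: "word_code enc u = word_code enc v \<longleftrightarrow> u = v"
proof -
  have "inj enc" using enc by (simp add: bij_betw_def)
  then show ?thesis unfolding word_code_def by (simp add: list_encode_eq inj_map_eq_map)
qed

lemma word_eq_iff: "word n a = word n b \<longleftrightarrow> a mod q ^ n = b mod q ^ n"
proof -
  have "word n a = word n b \<longleftrightarrow> (\<forall>i<n. dig q a i = dig q b i)"
  proof -
    have "dec (dig q a i) = dec (dig q b i) \<longleftrightarrow> dig q a i = dig q b i" for i
      by (metis dig_less enc_dec q_pos)
    then show ?thesis by (auto simp: word_def)
  qed
  then show ?thesis by (simp add: mod_power_eq_iff_dig q_pos)
qed

lemma ex_number_with_cells: "\<exists>m. \<forall>i<n. dec (dig q m i) = a i"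
  using dig_sum[of "\<lambda>i. enc (a i)" q _ n] enc_less
  by (intro exI[of _ "\<Sum>j<n. enc (a j) * q ^ j"]) auto

lemma ex_word: "\<exists>m<q ^ length u. word (length u) m = u"
proof -
  obtain m where m: "\<forall>i<length u. dec (dig q m i) = u ! i"
    using ex_number_with_cells by blast
  then have "word (length u) m = u" by (intro nth_equalityI) (auto simp: word_def)
  then have "word (length u) (m mod q ^ length u) = u"
    using word_eq_iff[of "length u" m "m mod q ^ length u"] by simp
  then show ?thesis by (intro exI[of _ "m mod q ^ length u"]) (simp add: q_pos)
qed

text \<open>The value 0 beyond the codes of neighbourhoods provides the finite support that
  \<open>computable_table\<close> asks for.\<close>

definition table :: "nat \<Rightarrow> nat" where
  "table N = (if N < q ^ (2 * r + 1) then enc (\<delta> (word (2 * r + 1) N)) else 0)"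

definition step :: "nat \<Rightarrow> nat \<Rightarrow> nat" where
  "step L m = (\<Sum>i<L. table (m div q ^ i mod q ^ (2 * r + 1)) * q ^ i)"

lemma conf_step:
  assumes "0 \<le> z" "z < int L"
  shows "conf (step L m) z = G (conf m) z"
proof -
  let ?N = "m div q ^ nat z mod q ^ (2 * r + 1)"
  have "table n < q" for n
    using enc_less q_pos by (simp add: table_def)
  then have "conf (step L m) z = dec (table ?N)"
    unfolding conf_def step_def using assms by (subst dig_sum) auto
  also have "\<dots> = \<delta> (word (2 * r + 1) ?N)"
    using q_pos by (simp add: table_def del: power_Suc)
  also have "word (2 * r + 1) ?N = map (\<lambda>i. conf m (z + int i)) [0..<2 * r + 1]"
  proof -
    have "dig q ?N i = dig q m (nat (z + int i))" if "i < 2 * r + 1" for i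
      using that assms(1) by (subst dig_mod_power) (simp_all add: q_pos dig_div_power nat_add_distrib)
    then show ?thesis unfolding word_def conf_def by (intro map_cong) auto
  qed
  finally show ?thesis by (simp add: ca_onesided_def)
qed

text \<open>\<open>step L\<close> cuts its result to \<open>L\<close> digits, so later steps read
  the digit 0 beyond the end. The resulting errors move left by at most \<open>2r\<close> cells per
  step, and the bound on \<open>z\<close> stays clear of them.\<close>

lemma conf_step_pow:
  assumes "0 \<le> z" "z + int (2 * r * t) < int L"
  shows "conf ((step L ^^ t) m) z = (G ^^ t) (conf m) z"
  using assms
proof (induction t arbitrary: z)
  case (Suc t)
  have "conf ((step L ^^ t) m) (z + int i) = (G ^^ t) (conf m) (z + int i)"
    if "i < 2 * r + 1" for i
    using Suc.prems that by (intro Suc.IH) (auto simp: algebra_simps)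
  then have "G (conf ((step L ^^ t) m)) z = G ((G ^^ t) (conf m)) z"
    by (rule ca_onesided_cong)
  moreover have "conf (step L ((step L ^^ t) m)) z = G (conf ((step L ^^ t) m)) z"
    using Suc.prems of_nat_0_le_iff[of "2 * r * Suc t"] by (intro conf_step; linarith)
  ultimately show ?case by simp
qed simp

lemma computable_step:
  assumes "computable_fun k f" "computable_fun k g"
  shows "computable_fun k (\<lambda>xs. step (f xs) (g xs))"
proof (rule computable_comp2[OF _ assms])
  show "computable_fun 2 (\<lambda>xs. step (xs ! 0) (xs ! 1))"
    unfolding step_def
    by (intro computable_arith computable_div computable_mod
          computable_table[where B = "q ^ (2 * r + 1)" and T = table])
      (auto simp: table_def)
qed

lemma computable_step_pow:
  assumes "computable_fun k f" "computable_fun k g" "computable_fun k h"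
  shows "computable_fun k (\<lambda>xs. (step (f xs) ^^ g xs) (h xs))"
proof (rule computable_comp3[OF _ assms])
  have "computable_fun 3 (\<lambda>xs. ((\<lambda>y. step (xs ! 0) y) ^^ (xs ! 1)) (xs ! 2))"
    by (intro computable_funpow computable_step computable_arith) auto
  then show "computable_fun 3 (\<lambda>xs. (step (xs ! 0) ^^ (xs ! 1)) (xs ! 2))" by simp
qed

lemma translate_in_cyl_word_iff:
  "translate (int i) c \<in> cyl (word n k) \<longleftrightarrow> (\<forall>j<n. c (int i + int j) = dec (dig q k j))"
  by (auto simp: translate_def cyl_def word_def add_ac)

text \<open>The bridge from arithmetic to dynamics for both parts: \<open>c\<close> is either a
  point of a cylinder, with \<open>i = 0\<close>, or a periodic configuration in whose image the
  word sits at position \<open>i\<close>.\<close>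

lemma step_pow_mod_eq_iff:
  assumes c: "\<And>z. 0 \<le> z \<Longrightarrow> z < int L \<Longrightarrow> c z = conf m z" and L: "i + n + 2 * r * t \<le> L"
  shows "(step L ^^ t) m div q ^ i mod q ^ n = k mod q ^ n \<longleftrightarrow>
    translate (int i) ((G ^^ t) c) \<in> cyl (word n k)"
proof -
  have "(step L ^^ t) m div q ^ i mod q ^ n = k mod q ^ n \<longleftrightarrow>
      (\<forall>j<n. dec (dig q ((step L ^^ t) m) (i + j)) = dec (dig q k j))"
    unfolding mod_power_eq_iff_dig[OF q_pos] dig_div_power
    by (metis dig_less enc_dec q_pos)
  also have "\<dots> \<longleftrightarrow> (\<forall>j<n. (G ^^ t) c (int i + int j) = dec (dig q k j))"
  proof -
    have "dec (dig q ((step L ^^ t) m) (i + j)) = (G ^^ t) c (int i + int j)" if "j < n" for j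
    proof -
      have "i + j + 2 * r * t < L" using that L by simp
      then have L': "int i + int j + int (2 * r * t) < int L" by linarith
      have "dec (dig q ((step L ^^ t) m) (i + j)) = conf ((step L ^^ t) m) (int i + int j)"
        by (simp add: conf_def nat_add_distrib)
      also have "\<dots> = (G ^^ t) (conf m) (int i + int j)"
        using L' by (intro conf_step_pow) auto
      also have "\<dots> = (G ^^ t) c (int i + int j)"
        using L' c by (intro ca_onesided_pow_local[where a = 0 and b = "int L"]) auto
      finally show ?thesis .
    qed
    then show ?thesis by simp
  qed
  finally show ?thesis by (simp add: translate_in_cyl_word_iff)
qed

end

section \<open>Shift-invariant measures\<close>

locale automaton_measure = coded_automaton r \<delta> enc q + prob_space M
  for r :: nat and \<delta> :: "'q::finite list \<Rightarrow> 'q" and enc :: "'q \<Rightarrow> nat" and q :: nat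
    and M :: "(int \<Rightarrow> 'q) measure" +
  assumes sets_M: "sets M = sets conf_space" and invariant: "shift_invariant M"
begin

lemma space_M: "space M = UNIV"
proof -
  have "space M = space (conf_space :: (int \<Rightarrow> 'q) measure)"
    by (rule sets_eq_imp_space_eq) (rule sets_M)
  then show ?thesis by (simp add: conf_space_def space_PiM PiE_UNIV_domain)
qed

lemma measurable_translate: "translate k \<in> measurable M M"
proof -
  have "translate k \<in> measurable conf_space (conf_space :: (int \<Rightarrow> 'q) measure)"
    unfolding conf_space_def translate_def
    by (rule measurable_PiM_single') (auto intro: measurable_component_singleton simp: space_PiM)
  then show ?thesis using sets_M measurable_cong_sets by blast
qed

lemma sets_translate_vimage: "A \<in> sets M \<Longrightarrow> translate k -` A \<in> sets M"
  using measurable_sets[OF measurable_translate, of A k] by (simp add: space_M)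

text \<open>\<open>shift_invariant\<close> speaks of one step in one direction. Iteration gives the
  nonnegative translations, and a negative one follows by applying the positive case to the
  translated set.\<close>

lemma measure_translate_vimage:
  assumes A: "A \<in> sets M"
  shows "measure M (translate k -` A) = measure M A"
proof -
  have nat: "measure M (translate (int n) -` A) = measure M A" if A: "A \<in> sets M" for n A
  proof (induction n)
    case 0
    show ?case by (simp add: vimage_def)
  next
    case (Suc n)
    have "translate (int (Suc n)) -` A = shift -` (translate (int n) -` A)"
      by (auto simp: translate_def shift_def vimage_def add_ac)
    then show ?case
      using invariant sets_translate_vimage[OF A] Suc by (simp add: shift_invariant_def)
  qed
  show ?thesis
  proof (cases "0 \<le> k")
    case True
    then show ?thesis using nat[OF A, of "nat k"] by simp
  next
    case False
    have "translate (- k) -` (translate k -` A) = A"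
      by (auto simp: vimage_def translate_translate)
    then show ?thesis
      using nat[OF sets_translate_vimage[OF A, of k], of "nat (- k)"] False by simp
  qed
qed

lemma sets_cyl: "cyl u \<in> sets M"
proof -
  have "cyl u = {c \<in> space M. \<forall>i\<in>{..<length u}. c (int i) = u ! i}"
    by (auto simp: cyl_def space_M)
  also have "\<dots> \<in> sets M"
  proof (rule sets.sets_Collect_finite_All)
    fix i
    have "(\<lambda>c. c (int i)) \<in> measurable conf_space (count_space (UNIV :: 'q set))"
      unfolding conf_space_def by (rule measurable_component_singleton) simp
    then have "(\<lambda>c. c (int i)) \<in> measurable M (count_space (UNIV :: 'q set))"
      using sets_M measurable_cong_sets by blast
    then have "(\<lambda>c. c (int i)) -` {u ! i} \<inter> space M \<in> sets M"
      by (rule measurable_sets) simp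
    also have "(\<lambda>c. c (int i)) -` {u ! i} \<inter> space M = {c \<in> space M. c (int i) = u ! i}" by auto
    finally show "{c \<in> space M. c (int i) = u ! i} \<in> sets M" .
  qed simp
  finally show ?thesis .
qed

lemma G_pow_vimage_eq: "(G ^^ t) -` A = translate (int (r * t)) -` ((F ^^ t) -` A)"
  by (auto simp: ca_onesided_pow ca_global_pow_translate)

lemma F_pow_vimage_eq: "(F ^^ t) -` A = translate (- int (r * t)) -` ((G ^^ t) -` A)"
  unfolding G_pow_vimage_eq by (auto simp: vimage_def translate_translate)

lemma in_cyl_word_iff: "c \<in> cyl (word L m) \<longleftrightarrow> (\<forall>z. 0 \<le> z \<longrightarrow> z < int L \<longrightarrow> c z = conf m z)"
proof
  assume c: "c \<in> cyl (word L m)"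
  show "\<forall>z. 0 \<le> z \<longrightarrow> z < int L \<longrightarrow> c z = conf m z"
  proof (intro allI impI)
    fix z assume z: "0 \<le> z" "z < int L"
    then have "nat z < L" by simp
    then have "c (int (nat z)) = dec (dig q m (nat z))"
      using c by (auto simp: cyl_def word_def)
    then show "c z = conf m z" using z by (simp add: conf_def)
  qed
qed (auto simp: cyl_def word_def conf_def)

lemma ex_cyl_word: "\<exists>m<q ^ L. c \<in> cyl (word L m)"
proof -
  obtain m where "m < q ^ L" "word L m = map (\<lambda>i. c (int i)) [0..<L]"
    using ex_word[of "map (\<lambda>i. c (int i)) [0..<L]"] by auto
  moreover have "c \<in> cyl (map (\<lambda>i. c (int i)) [0..<L])" by (simp add: cyl_def)
  ultimately show ?thesis by metis
qed

text \<open>An image word of length \<open>n\<close> depends on \<open>n + 2rt\<close> cells only,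
  and the contents of these cells are the numbers below \<open>q ^ L\<close>.\<close>

lemma G_pow_vimage_cyl:
  assumes L: "L = n + 2 * r * t"
  shows "(G ^^ t) -` cyl (word n k) =
    (\<Union>m\<in>{m. m < q ^ L \<and> (step L ^^ t) m mod q ^ n = k mod q ^ n}. cyl (word L m))"
proof -
  have *: "(step L ^^ t) m mod q ^ n = k mod q ^ n \<longleftrightarrow> (G ^^ t) c \<in> cyl (word n k)"
    if "c \<in> cyl (word L m)" for c m
    using step_pow_mod_eq_iff[of L c m 0 n t k] that L by (auto simp: in_cyl_word_iff)
  show ?thesis
  proof (intro set_eqI iffI)
    fix c assume c: "c \<in> (G ^^ t) -` cyl (word n k)"
    obtain m where m: "m < q ^ L" "c \<in> cyl (word L m)" using ex_cyl_word by blast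
    with c * show "c \<in> (\<Union>m\<in>{m. m < q ^ L \<and> (step L ^^ t) m mod q ^ n = k mod q ^ n}. cyl (word L m))"
      by auto
  qed (use * in auto)
qed

lemma disjoint_cyl_word: "disjoint_family_on (\<lambda>m. cyl (word L m)) {m. m < q ^ L \<and> P m}"
proof -
  have "a = b" if "a < q ^ L" "b < q ^ L" "c \<in> cyl (word L a)" "c \<in> cyl (word L b)" for a b c
  proof -
    have "word L a = word L b"
      using that(3,4) by (intro nth_equalityI) (auto simp: cyl_def)
    then show ?thesis using that(1,2) by (simp add: word_eq_iff)
  qed
  then show ?thesis unfolding disjoint_family_on_def by blast
qed

text \<open>Measurability comes from the decomposition into finitely many cylinders, moved back by a
  translation, instead of from continuity.\<close>

lemma sets_F_pow_vimage: "(F ^^ t) -` cyl u \<in> sets M"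
proof -
  obtain k where k: "word (length u) k = u" using ex_word by blast
  have "(G ^^ t) -` cyl (word (length u) k) \<in> sets M"
    unfolding G_pow_vimage_cyl[OF refl] by (intro sets.finite_UN) (auto simp: sets_cyl)
  then show ?thesis unfolding F_pow_vimage_eq k by (rule sets_translate_vimage)
qed

lemma measure_F_pow_vimage:
  assumes L: "L = n + 2 * r * t"
  shows "measure M ((F ^^ t) -` cyl (word n k)) =
    (\<Sum>m\<in>{m. m < q ^ L \<and> (step L ^^ t) m mod q ^ n = k mod q ^ n}. measure M (cyl (word L m)))"
proof -
  have "measure M ((F ^^ t) -` cyl (word n k)) = measure M ((G ^^ t) -` cyl (word n k))"
    unfolding G_pow_vimage_eq by (rule measure_translate_vimage[symmetric, OF sets_F_pow_vimage])
  also have "\<dots> = (\<Sum>m\<in>{m. m < q ^ L \<and> (step L ^^ t) m mod q ^ n = k mod q ^ n}.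
      measure M (cyl (word L m)))"
    unfolding G_pow_vimage_cyl[OF L]
    by (rule finite_measure_finite_Union) (use disjoint_cyl_word sets_cyl in auto)
  finally show ?thesis .
qed

lemma limit_lang_iff_frequently:
  "u \<in> limit_lang r \<delta> M \<longleftrightarrow> (\<exists>\<epsilon>>0. \<forall>T. \<exists>t\<ge>T. \<epsilon> \<le> measure M ((F ^^ t) -` cyl u))"
  unfolding limit_lang_def lim_sequentially by (auto simp: not_less)

end

section \<open>Computable measures\<close>

lemma rat_decode_eq: "real_of_rat (rat_decode (prod_encode (a, b))) = real_of_int (int_decode a) / real b"
  by (simp add: rat_decode_def of_rat_divide)

context automaton_measure
begin

context
  fixes f :: "nat list \<Rightarrow> nat"
  assumes f: "computable_fun 2 f"
    and f_approx: "\<And>u e. rat_decode e > 0 \<Longrightarrow>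
        \<bar>measure M (cyl u) - real_of_rat (rat_decode (f [word_code enc u, e]))\<bar>
          \<le> real_of_rat (rat_decode e)"
begin

text \<open>Since \<^term>\<open>int_encode 1 = 2\<close>, the numeral \<^term>\<open>prod_encode (2, N)\<close> codes the
  precision $1/N$; odd codes of integers are those of the negative ones.\<close>
definition numerator :: "nat \<Rightarrow> nat \<Rightarrow> nat" where
  "numerator v N = (let z = f [v, prod_encode (2, N)] in
     if fst (prod_decode z) mod 2 = 0
     then N * (fst (prod_decode z) div 2) div snd (prod_decode z) else 0)"

text \<open>One \<open>1 / N\<close> is the precision requested from \<open>f\<close>, the other
  pays for rounding down to a multiple of \<open>1 / N\<close>. Replacing a negative approximant by
  0 brings it closer to a measure. A zero denominator is consistent: the real and the integer
  quotient are then both 0.\<close>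

lemma numerator_approx:
  assumes N: "0 < N"
  shows "\<bar>measure M (cyl u) - real (numerator (word_code enc u) N) / real N\<bar> \<le> 2 / real N"
proof -
  let ?e = "prod_encode (2, N)"
  obtain a b where ab: "prod_decode (f [word_code enc u, ?e]) = (a, b)" by fastforce
  then have z: "f [word_code enc u, ?e] = prod_encode (a, b)" by (metis prod_decode_inverse)
  have two: "int_decode 2 = 1" by (simp add: int_decode_def sum_decode_def)
  then have e: "real_of_rat (rat_decode ?e) = 1 / real N" by (simp add: rat_decode_eq)
  then have "rat_decode ?e > 0" using N by (metis of_nat_0_less_iff zero_less_divide_1_iff zero_less_of_rat_iff)
  from f_approx[OF this, of u]
  have approx: "\<bar>measure M (cyl u) - real_of_int (int_decode a) / real b\<bar> \<le> 1 / real N"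
    by (simp add: z rat_decode_eq two)
  show ?thesis
  proof (cases "a mod 2 = 0")
    case True
    let ?x = "N * (a div 2)"
    have num: "numerator (word_code enc u) N = ?x div b"
      using True by (simp add: numerator_def ab)
    have "int_decode a = int (a div 2)"
      using True by (simp add: int_decode_def sum_decode_def even_iff_mod_2_eq_zero)
    then have "real_of_int (int_decode a) / real b = (real ?x / real b) / real N"
      using N by simp
    moreover have "\<bar>real ?x / real b - real (?x div b)\<bar> \<le> 1"
      using floor_correct[of "real ?x / real b"] unfolding floor_divide_of_nat_eq by linarith
    then have "\<bar>(real ?x / real b) / real N - real (?x div b) / real N\<bar> \<le> 1 / real N"
      by (simp only: diff_divide_distrib[symmetric] abs_divide abs_of_nat divide_right_mono of_nat_0_le_iff)
    ultimately show ?thesis using approx unfolding num by linarith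
  next
    case False
    then have "int_decode a \<le> 0"
      by (simp add: int_decode_def sum_decode_def even_iff_mod_2_eq_zero)
    then have "real_of_int (int_decode a) / real b \<le> 0"
      by (simp add: divide_nonpos_nonneg)
    moreover have "numerator (word_code enc u) N = 0"
      using False by (simp add: numerator_def ab)
    moreover have "1 / real N \<le> 2 / real N" by (intro divide_right_mono) auto
    then have "measure M (cyl u) \<le> 2 / real N" using approx calculation(1) by linarith
    ultimately show ?thesis by simp
  qed
qed

text \<open>With \<open>L = n + 2 * r * t\<close>, the common denominator is
  \<open>2 * Suc a * q ^ L\<close>: at most \<open>q ^ L\<close> cylinders, each with an error of 2
  over this denominator, add up to at most \<open>1 / Suc a\<close>.\<close>

definition numerator_sum :: "nat \<Rightarrow> nat \<Rightarrow> nat \<Rightarrow> nat \<Rightarrow> nat" where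
  "numerator_sum a n k t = (\<Sum>m<q ^ (n + 2 * r * t).
     if (step (n + 2 * r * t) ^^ t) m mod q ^ n = k mod q ^ n
     then numerator (digits_code q (n + 2 * r * t) m) (2 * Suc a * q ^ (n + 2 * r * t)) else 0)"

lemma numerator_sum_approx:
  assumes N: "N = 2 * Suc a * q ^ (n + 2 * r * t)"
  shows "\<bar>measure M ((F ^^ t) -` cyl (word n k)) - real (numerator_sum a n k t) / real N\<bar> \<le> 1 / real (Suc a)"
proof -
  define L where "L = n + 2 * r * t"
  define A where "A = {m. m < q ^ L \<and> (step L ^^ t) m mod q ^ n = k mod q ^ n}"
  have "0 < N" using q_pos by (simp add: N)
  have "numerator_sum a n k t = (\<Sum>m\<in>{..<q ^ L}.
      if (step L ^^ t) m mod q ^ n = k mod q ^ n then numerator (digits_code q L m) N else 0)"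
    by (simp only: numerator_sum_def L_def N)
  also have "\<dots> = (\<Sum>m\<in>{m \<in> {..<q ^ L}. (step L ^^ t) m mod q ^ n = k mod q ^ n}.
      numerator (digits_code q L m) N)"
    by (rule sum.inter_filter[symmetric]) simp
  finally have "real (numerator_sum a n k t) / real N =
      (\<Sum>m\<in>A. real (numerator (digits_code q L m) N) / real N)"
    by (simp add: A_def sum_divide_distrib)
  moreover have "measure M ((F ^^ t) -` cyl (word n k)) = (\<Sum>m\<in>A. measure M (cyl (word L m)))"
    unfolding A_def by (rule measure_F_pow_vimage) (rule L_def)
  ultimately have "\<bar>measure M ((F ^^ t) -` cyl (word n k)) - real (numerator_sum a n k t) / real N\<bar>
      = \<bar>\<Sum>m\<in>A. measure M (cyl (word L m)) - real (numerator (digits_code q L m) N) / real N\<bar>"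
    by (simp add: sum_subtractf)
  also have "\<dots> \<le> (\<Sum>m\<in>A. \<bar>measure M (cyl (word L m)) - real (numerator (digits_code q L m) N) / real N\<bar>)"
    by (rule sum_abs)
  also have "\<dots> \<le> (\<Sum>m\<in>A. 2 / real N)"
    by (rule sum_mono) (metis numerator_approx \<open>0 < N\<close> word_code_word)
  also have "\<dots> = real (card A) * (2 / real N)" by simp
  also have "\<dots> \<le> real (q ^ L) * (2 / real N)"
  proof -
    have "card A \<le> card {..<q ^ L}" unfolding A_def by (rule card_mono) auto
    then have "real (card A) \<le> real (q ^ L)" by (simp only: card_lessThan of_nat_le_iff)
    then show ?thesis by (rule mult_right_mono) simp
  qed
  also have "\<dots> = 1 / real (Suc a)"
  proof -
    have "B * (2 / (2 * A * B)) = 1 / A" if "0 < A" "0 < B" for A B :: real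
      using that by simp
    from this[of "real (Suc a)" "real (q ^ L)"] show ?thesis
      using q_pos unfolding N L_def[symmetric] by (simp only: of_nat_mult of_nat_numeral) simp
  qed
  finally show ?thesis .
qed

lemma computable_numerator_sum:
  assumes "computable_fun k f1" "computable_fun k f2" "computable_fun k f3" "computable_fun k f4"
  shows "computable_fun k (\<lambda>xs. numerator_sum (f1 xs) (f2 xs) (f3 xs) (f4 xs))"
proof (rule computable_comp4[OF _ assms])
  have "computable_fun 2 (\<lambda>xs. numerator (xs ! 0) (xs ! 1))"
    unfolding numerator_def Let_def
    by (intro computable_arith computable_div computable_mod computable_prod_decode_fst
          computable_prod_decode_snd computable_comp_list2[OF f] computable_prod_encode) auto
  note num = computable_comp2[where F = numerator, OF this]
  show "computable_fun 4 (\<lambda>xs. numerator_sum (xs ! 0) (xs ! 1) (xs ! 2) (xs ! 3))"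
    unfolding numerator_sum_def
    by (intro computable_arith computable_mod num computable_digits_code computable_step_pow) auto
qed

text \<open>The inequality says that an approximant with error \<open>1 / Suc a\<close> exceeds
  \<open>2 / Suc a\<close>. It forces a measure of at least \<open>1 / Suc a\<close>, and is forced
  by a measure above \<open>3 / Suc a\<close>; the gap between the two is harmless because
  \<open>a\<close> is quantified existentially.\<close>

lemma limit_lang_word_iff:
  "word n k \<in> limit_lang r \<delta> M \<longleftrightarrow>
    (\<exists>a. \<forall>b. \<exists>t\<ge>b. 4 * q ^ (n + 2 * r * t) < numerator_sum a n k t)"
proof -
  let ?\<mu> = "\<lambda>t. measure M ((F ^^ t) -` cyl (word n k))"
  have sum_gt: "4 * q ^ (n + 2 * r * t) < numerator_sum a n k t \<longleftrightarrow>
      2 / real (Suc a) < real (numerator_sum a n k t) / real (2 * Suc a * q ^ (n + 2 * r * t))" for a t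
  proof -
    let ?Q = "q ^ (n + 2 * r * t)"
    have Q: "0 < real ?Q" using q_pos by simp
    have "2 / real (Suc a) = real (4 * ?Q) / real (2 * Suc a * ?Q)"
    proof -
      have "2 / A = 4 * B / (2 * A * B)" if "0 < A" "0 < B" for A B :: real
        using that by simp
      from this[OF _ Q, of "real (Suc a)"] show ?thesis by (simp only: of_nat_mult of_nat_numeral)
    qed
    also have "\<dots> < real (numerator_sum a n k t) / real (2 * Suc a * ?Q) \<longleftrightarrow>
        real (4 * ?Q) < real (numerator_sum a n k t)"
    proof -
      have "A / C < B / C \<longleftrightarrow> A < B" if "0 < C" for A B C :: real
        using that by (simp add: divide_less_cancel)
      moreover have "0 < real (2 * Suc a * ?Q)"
        using q_pos by (simp only: of_nat_0_less_iff) simp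
      ultimately show ?thesis by blast
    qed
    finally show ?thesis by (simp only: of_nat_less_iff)
  qed
  note approx = numerator_sum_approx[OF refl, of _ _ k]
  show ?thesis unfolding limit_lang_iff_frequently
  proof
    assume "\<exists>\<epsilon>>0. \<forall>T. \<exists>t\<ge>T. \<epsilon> \<le> ?\<mu> t"
    then obtain \<epsilon> where \<epsilon>: "\<epsilon> > 0" "\<forall>T. \<exists>t\<ge>T. \<epsilon> \<le> ?\<mu> t" by blast
    obtain a where "inverse (real (Suc a)) < \<epsilon> / 3"
      using reals_Archimedean[of "\<epsilon> / 3"] \<epsilon>(1) by auto
    then have a: "3 / real (Suc a) < \<epsilon>" by (simp add: field_simps)
    have split: "3 / real (Suc a) = 2 / real (Suc a) + 1 / real (Suc a)"
      by (simp add: add_divide_distrib[symmetric])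
    have "4 * q ^ (n + 2 * r * t) < numerator_sum a n k t" if "\<epsilon> \<le> ?\<mu> t" for t
      unfolding sum_gt using approx[where a = a and n = n and t = t] that a split by linarith
    then show "\<exists>a. \<forall>b. \<exists>t\<ge>b. 4 * q ^ (n + 2 * r * t) < numerator_sum a n k t"
      using \<epsilon>(2) by blast
  next
    assume "\<exists>a. \<forall>b. \<exists>t\<ge>b. 4 * q ^ (n + 2 * r * t) < numerator_sum a n k t"
    then obtain a where a: "\<forall>b. \<exists>t\<ge>b. 4 * q ^ (n + 2 * r * t) < numerator_sum a n k t" by blast
    have split: "2 / real (Suc a) = 1 / real (Suc a) + 1 / real (Suc a)"
      by (simp add: add_divide_distrib[symmetric])
    have "1 / real (Suc a) \<le> ?\<mu> t" if "4 * q ^ (n + 2 * r * t) < numerator_sum a n k t" for t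
      using that unfolding sum_gt using approx[where a = a and n = n and t = t] split by linarith
    then have "\<forall>T. \<exists>t\<ge>T. 1 / real (Suc a) \<le> ?\<mu> t" using a by blast
    then show "\<exists>\<epsilon>>0. \<forall>T. \<exists>t\<ge>T. \<epsilon> \<le> ?\<mu> t"
      by (intro exI[of _ "1 / real (Suc a)"]) auto
  qed
qed

text \<open>The innermost quantifier guesses the time together with a length and a numeral for the
  input word. Thus words are only ever encoded, never decoded.\<close>

lemma Sigma3_limit_lang_aux: "Sigma3 (word_code enc ` limit_lang r \<delta> M)"
proof -
  define P where "P x a b t n k \<longleftrightarrow> b \<le> t \<and> x = digits_code q n k \<and>
      4 * q ^ (n + 2 * r * t) < numerator_sum a n k t" for x a b t n k
  define R where "R xs = P (xs ! 0) (xs ! 1) (xs ! 2)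
      (component 0 (xs ! 3)) (component 1 (xs ! 3)) (component 2 (xs ! 3))" for xs
  have "decidable_rel 4 R"
    unfolding R_def P_def
    by (intro computable_arith computable_digits_code computable_numerator_sum computable_component) auto
  moreover have "word_code enc ` limit_lang r \<delta> M = {x. \<exists>a. \<forall>b. \<exists>c. R [x, a, b, c]}"
  proof -
    have R_iff: "(\<exists>c. R [x, a, b, c]) \<longleftrightarrow> (\<exists>t n k. P x a b t n k)" for x a b
    proof
      assume "\<exists>t n k. P x a b t n k"
      then obtain t n k where P: "P x a b t n k" by blast
      obtain c where c: "\<forall>j<length [t, n, k]. component j c = [t, n, k] ! j"
        using ex_components by blast
      have "component 0 c = t" "component 1 c = n" "component 2 c = k"
        using c[rule_format, of 0] c[rule_format, of 1] c[rule_format, of 2] by auto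
      then have "R [x, a, b, c]" using P by (simp add: R_def)
      then show "\<exists>c. R [x, a, b, c]" by blast
    qed (auto simp: R_def)
    have iff: "x \<in> word_code enc ` limit_lang r \<delta> M \<longleftrightarrow> (\<exists>a. \<forall>b. \<exists>t n k. P x a b t n k)" for x
    proof
      assume "x \<in> word_code enc ` limit_lang r \<delta> M"
      then obtain u where u: "u \<in> limit_lang r \<delta> M" "x = word_code enc u" by blast
      obtain k where k: "word (length u) k = u" using ex_word by blast
      have "x = digits_code q (length u) k" using u(2) k word_code_word by metis
      moreover have "\<exists>a. \<forall>b. \<exists>t\<ge>b. 4 * q ^ (length u + 2 * r * t) < numerator_sum a (length u) k t"
        using u(1) k limit_lang_word_iff by metis
      ultimately show "\<exists>a. \<forall>b. \<exists>t n k. P x a b t n k" unfolding P_def by blast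
    next
      assume "\<exists>a. \<forall>b. \<exists>t n k. P x a b t n k"
      then obtain a where a: "\<forall>b. \<exists>t n k. P x a b t n k" by blast
      then obtain t n k where "P x a 0 t n k" by blast
      then have x: "x = word_code enc (word n k)" by (simp add: P_def word_code_word)
      \<comment> \<open>The guess may change with \<open>b\<close>, but the code determines the
        word, and \<open>numerator_sum\<close> depends on the numeral only modulo
        \<open>q ^ n\<close>.\<close>
      have "\<exists>t\<ge>b. 4 * q ^ (n + 2 * r * t) < numerator_sum a n k t" for b
      proof -
        obtain t' n' k' where P: "P x a b t' n' k'" using a by blast
        then have "word_code enc (word n k) = word_code enc (word n' k')"
          using x by (simp add: P_def word_code_word)
        then have eq: "word n k = word n' k'" by (simp only: word_code_inj)
        then have n: "n' = n" by (metis length_word)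
        then have "k mod q ^ n = k' mod q ^ n" using eq by (simp add: word_eq_iff)
        then have "numerator_sum a n k' t' = numerator_sum a n k t'"
          by (simp add: numerator_sum_def)
        then show ?thesis using P n by (auto simp: P_def)
      qed
      then have "word n k \<in> limit_lang r \<delta> M" using limit_lang_word_iff by blast
      then show "x \<in> word_code enc ` limit_lang r \<delta> M" using x by blast
    qed
    show ?thesis by (rule set_eqI) (unfold mem_Collect_eq iff R_iff, rule refl)
  qed
  ultimately show ?thesis unfolding Sigma3_def by blast
qed

end

lemma Sigma3_limit_lang:
  assumes "computable_measure enc M"
  shows "Sigma3 (word_code enc ` limit_lang r \<delta> M)"
proof -
  obtain f where "computable_fun 2 f" "\<And>u e. rat_decode e > 0 \<Longrightarrow>
        \<bar>measure M (cyl u) - real_of_rat (rat_decode (f [word_code enc u, e]))\<bar>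
          \<le> real_of_rat (rat_decode e)"
    using assms unfolding computable_measure_def by blast
  then show ?thesis by (rule Sigma3_limit_lang_aux)
qed

end

section \<open>Equicontinuity points and blocking words\<close>

lemma cantor_dist_less:
  assumes "\<And>i. \<bar>i\<bar> \<le> int n \<Longrightarrow> x i = y i"
  shows "cantor_dist x y < 2 powr - real n"
proof (cases "x = y")
  case False
  let ?P = "\<lambda>n. \<exists>i. \<bar>i\<bar> = int n \<and> x i \<noteq> y i"
  obtain i where "x i \<noteq> y i" using False by blast
  then have "?P (nat \<bar>i\<bar>)" by (intro exI[of _ i]) auto
  then have "?P (LEAST n. ?P n)" by (rule LeastI)
  then obtain j where j: "\<bar>j\<bar> = int (LEAST n. ?P n)" "x j \<noteq> y j" by blast
  then have "\<not> \<bar>j\<bar> \<le> int n" using assms by blast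
  then have "n < (LEAST n. ?P n)" using j(1) by linarith
  then show ?thesis using False by (simp add: cantor_dist_def)
qed (simp add: cantor_dist_def)

lemma eq_if_cantor_dist_less:
  assumes "cantor_dist x y < 2 powr - real n" "\<bar>i\<bar> \<le> int n"
  shows "x i = y i"
proof (rule ccontr)
  let ?P = "\<lambda>n. \<exists>i. \<bar>i\<bar> = int n \<and> x i \<noteq> y i"
  assume neq: "x i \<noteq> y i"
  then have "?P (nat \<bar>i\<bar>)" by (intro exI[of _ i]) auto
  then have "(LEAST n. ?P n) \<le> nat \<bar>i\<bar>" by (rule Least_le)
  then have "2 powr - real n \<le> 2 powr - real (LEAST n. ?P n)" using assms(2) by simp
  moreover have "x \<noteq> y" using neq by blast
  ultimately show False using assms(1) by (simp add: cantor_dist_def)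
qed

definition blocking :: "nat \<Rightarrow> ('q list \<Rightarrow> 'q) \<Rightarrow> nat \<Rightarrow> (int \<Rightarrow> 'q) \<Rightarrow> bool" where
  "blocking r \<delta> n x \<longleftrightarrow> (\<forall>y. (\<forall>i. \<bar>i\<bar> \<le> int n \<longrightarrow> y i = x i) \<longrightarrow> (\<forall>t i. \<bar>i\<bar> \<le> int r \<longrightarrow>
     (ca_global r \<delta> ^^ t) y i = (ca_global r \<delta> ^^ t) x i))"

text \<open>Equicontinuity is applied at precision \<open>2 powr - real r\<close>, since a smaller
  distance means agreement on the cells \<open>-r..r\<close>; the matching \<open>d\<close> yields
  \<open>n\<close>.\<close>

lemma equicont_point_blocking:
  assumes "equicont_point r \<delta> x"
  shows "\<exists>n. blocking r \<delta> n x"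
proof -
  obtain d where d: "d > 0" and close: "\<And>y t. cantor_dist x y < d \<Longrightarrow>
      cantor_dist ((ca_global r \<delta> ^^ t) x) ((ca_global r \<delta> ^^ t) y) < 2 powr - real r"
    using assms unfolding equicont_point_def by (metis powr_gt_zero zero_neq_numeral)
  obtain n where "(1 / 2) ^ n < d" using real_arch_pow_inv[OF d, of "1 / 2"] by auto
  then have n: "2 powr - real n < d" by (simp add: powr_minus powr_realpow power_one_over inverse_eq_divide)
  have "blocking r \<delta> n x" unfolding blocking_def
  proof (intro allI impI)
    fix y t i assume y: "\<forall>i. \<bar>i\<bar> \<le> int n \<longrightarrow> y i = x i" and i: "\<bar>i\<bar> \<le> int r"
    have "cantor_dist x y < d" using cantor_dist_less[of n x y] y n by force
    from eq_if_cantor_dist_less[OF close[OF this] i]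
    show "(ca_global r \<delta> ^^ t) y i = (ca_global r \<delta> ^^ t) x i" by simp
  qed
  then show ?thesis by blast
qed

definition occurs :: "nat \<Rightarrow> (int \<Rightarrow> 'q) \<Rightarrow> (int \<Rightarrow> 'q) \<Rightarrow> int \<Rightarrow> bool" where
  "occurs n x c a \<longleftrightarrow> (\<forall>i. \<bar>i\<bar> \<le> int n \<longrightarrow> c (a + i) = x i)"

lemma occurs_translate: "occurs n x (translate k c) a \<longleftrightarrow> occurs n x c (a + k)"
  by (simp add: occurs_def translate_def add_ac)

lemma blocking_occurs:
  assumes "blocking r \<delta> n x" "occurs n x c a" "\<bar>i\<bar> \<le> int r"
  shows "(ca_global r \<delta> ^^ t) c (a + i) = (ca_global r \<delta> ^^ t) x i"
proof -
  have "\<forall>i. \<bar>i\<bar> \<le> int n \<longrightarrow> translate a c i = x i"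
    using assms(2) by (simp add: occurs_def translate_def add.commute)
  then have "(ca_global r \<delta> ^^ t) (translate a c) i = (ca_global r \<delta> ^^ t) x i"
    using assms(1,3) unfolding blocking_def by blast
  then show ?thesis
    unfolding ca_global_pow_translate by (simp add: translate_def add.commute)
qed

lemma ca_global_cong:
  assumes "\<And>i. \<bar>i\<bar> \<le> int r \<Longrightarrow> c (z + i) = c' (z + i)"
  shows "ca_global r \<delta> c z = ca_global r \<delta> c' z"
  unfolding ca_global_def using assms by (intro arg_cong[where f = \<delta>] map_cong) auto

text \<open>No information crosses an occurrence of a blocking word, because the strip it determines
  is at least as wide as the radius.\<close>
lemma blocking_between:
  assumes x: "blocking r \<delta> n x"
    and occ: "occurs n x c a" "occurs n x c b" "occurs n x c' a" "occurs n x c' b"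
    and eq: "\<And>z. a \<le> z \<Longrightarrow> z \<le> b \<Longrightarrow> c z = c' z"
    and z: "a \<le> z" "z \<le> b"
  shows "(ca_global r \<delta> ^^ t) c z = (ca_global r \<delta> ^^ t) c' z"
proof -
  have strip: "(ca_global r \<delta> ^^ t) c z = (ca_global r \<delta> ^^ t) c' z"
    if "\<bar>z - a\<bar> \<le> int r \<or> \<bar>z - b\<bar> \<le> int r" for t z
    using that blocking_occurs[OF x occ(1), of "z - a" t] blocking_occurs[OF x occ(3), of "z - a" t]
      blocking_occurs[OF x occ(2), of "z - b" t] blocking_occurs[OF x occ(4), of "z - b" t]
    by (cases "\<bar>z - a\<bar> \<le> int r") (simp_all del: funpow.simps)
  show ?thesis using z
  proof (induction t arbitrary: z)
    case (Suc t)
    show ?case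
    proof (cases "\<bar>z - a\<bar> \<le> int r \<or> \<bar>z - b\<bar> \<le> int r")
      case False
      \<comment> \<open>Away from both strips the whole neighbourhood of \<open>z\<close> lies
        between \<open>a\<close> and \<open>b\<close>, where the induction hypothesis
        applies.\<close>
      have "(ca_global r \<delta> ^^ t) c (z + i) = (ca_global r \<delta> ^^ t) c' (z + i)" if "\<bar>i\<bar> \<le> int r" for i
        using False that Suc.prems by (intro Suc.IH) auto
      then have "ca_global r \<delta> ((ca_global r \<delta> ^^ t) c) z = ca_global r \<delta> ((ca_global r \<delta> ^^ t) c') z"
        by (rule ca_global_cong)
      then show ?thesis by simp
    qed (rule strip)
  qed (use eq in simp)
qed

section \<open>Periodic configurations\<close>

lemma periodic_translate_mult:
  assumes "translate p y = y"
  shows "translate (k * p) y = y"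
proof -
  have nat: "translate (int n * p) y = y" for n
  proof (induction n)
    case (Suc n)
    have "translate (int (Suc n) * p) y = translate p (translate (int n * p) y)"
      unfolding translate_translate by (simp add: algebra_simps)
    then show ?case using Suc assms by simp
  qed simp
  show ?thesis
  proof (cases "0 \<le> k")
    case True
    then show ?thesis using nat[of "nat k"] by simp
  next
    case False
    then have "translate (- k * p) y = y" using nat[of "nat (- k)"] by simp
    then have "translate (k * p) y = translate (k * p) (translate (- k * p) y)" by simp
    also have "\<dots> = y" unfolding translate_translate by simp
    finally show ?thesis .
  qed
qed

lemma periodic_ca_global_pow:
  "translate p y = y \<Longrightarrow> translate p ((ca_global r \<delta> ^^ t) y) = (ca_global r \<delta> ^^ t) y"
  by (metis ca_global_pow_translate)

context coded_automaton
begin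

definition periodic_conf :: "nat \<Rightarrow> nat \<Rightarrow> int \<Rightarrow> 'q" where
  "periodic_conf p m z = dec (dig q m (nat (z mod int p)))"

lemma periodic_periodic_conf: "translate (int p) (periodic_conf p m) = periodic_conf p m"
  by (simp add: periodic_conf_def translate_def fun_eq_iff)

lemma ex_periodic_conf:
  assumes p: "0 < p" and y: "translate (int p) y = y"
  shows "\<exists>m<q ^ p. y = periodic_conf p m"
proof -
  define u where "u = map (\<lambda>i. y (int i)) [0..<p]"
  obtain m where m: "m < q ^ p" "word p m = u"
    using ex_word[of u] by (auto simp: u_def)
  have "y z = periodic_conf p m z" for z
  proof -
    have "y z = translate (z div int p * int p) y (z mod int p)"
      by (simp add: translate_def)
    also have "\<dots> = y (z mod int p)" by (simp only: periodic_translate_mult[OF y])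
    also have "\<dots> = u ! nat (z mod int p)" using p by (simp add: u_def nat_less_iff)
    also have "\<dots> = periodic_conf p m z"
      using p by (simp add: m(2)[symmetric] word_def periodic_conf_def nat_less_iff)
    finally show ?thesis .
  qed
  then show ?thesis using m(1) by blast
qed

text \<open>There are at most \<open>q ^ p\<close> configurations of period \<open>p\<close>, so by
  pigeonhole two of the times \<open>0..q ^ p\<close> give the same one. Any
  \<open>t >= q ^ p\<close> comes after the first of these two times, hence lies on the
  cycle.\<close>

lemma periodic_recurrence:
  assumes p: "0 < p" and y: "translate (int p) y = y" and t: "q ^ p \<le> t"
  shows "\<exists>t'\<ge>T. (F ^^ t') y = (F ^^ t) y"
proof -
  let ?P = "periodic_conf p ` {..<q ^ p}"
  have "(F ^^ s) y \<in> ?P" for s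
    using ex_periodic_conf[OF p periodic_ca_global_pow[OF y]] by blast
  then have sub: "(\<lambda>s. (F ^^ s) y) ` {..q ^ p} \<subseteq> ?P" by blast
  have "\<not> inj_on (\<lambda>s. (F ^^ s) y) {..q ^ p}"
  proof
    assume "inj_on (\<lambda>s. (F ^^ s) y) {..q ^ p}"
    then have "card {..q ^ p} \<le> card ?P" using sub by (intro card_inj_on_le) auto
    also have "\<dots> \<le> card {..<q ^ p}" by (rule card_image_le) simp
    finally show False by simp
  qed
  then obtain a b where ab: "a < b" "b \<le> q ^ p" "(F ^^ a) y = (F ^^ b) y"
    unfolding inj_on_def by (metis atMost_iff nat_neq_iff)
  have period: "(F ^^ (s + (b - a))) y = (F ^^ s) y" if "a \<le> s" for s
  proof -
    have "(F ^^ (s + (b - a))) y = (F ^^ (s - a)) ((F ^^ b) y)"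
      using that ab(1) by (simp flip: funpow_add[THEN fun_cong, unfolded comp_def])
    also have "\<dots> = (F ^^ (s - a)) ((F ^^ a) y)" by (simp only: ab(3))
    also have "\<dots> = (F ^^ s) y"
      using that by (simp flip: funpow_add[THEN fun_cong, unfolded comp_def])
    finally show ?thesis .
  qed
  have "(F ^^ (t + j * (b - a))) y = (F ^^ t) y" for j
  proof (induction j)
    case (Suc j)
    have "(F ^^ (t + j * (b - a) + (b - a))) y = (F ^^ (t + j * (b - a))) y"
      using t ab by (intro period) simp
    moreover have "t + Suc j * (b - a) = t + j * (b - a) + (b - a)" by simp
    ultimately show ?case using Suc by (simp only:)
  qed simp
  \<comment> \<open>The cycle length \<open>b - a\<close> is at least 1, so \<open>T\<close> rounds
    lead past time \<open>T\<close>.\<close>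
  moreover have "T \<le> t + T * (b - a)"
    using ab(1) by (metis le_add2 le_trans mult.right_neutral mult_le_mono2 Suc_leI zero_less_diff One_nat_def)
  ultimately show ?thesis by blast
qed

end

section \<open>Ergodic measures\<close>

context automaton_measure
begin

context
  fixes n :: nat and x :: "int \<Rightarrow> 'q" and w :: "'q list"
  assumes ergodic: "shift_ergodic M" and full: "full_support M" and x: "blocking r \<delta> n x"
  defines "w \<equiv> map (\<lambda>i. x (int i - int n)) [0..<2 * n + 1]"
begin

text \<open>\<open>occurs\<close> is indexed by the centre of the word and \<open>cyl\<close> by its
  left end, hence the offset \<open>n\<close>.\<close>

lemma occurs_iff_cyl: "occurs n x c a \<longleftrightarrow> translate (a - int n) c \<in> cyl w"
proof
  assume occ: "occurs n x c a"
  have "c (a + (int i - int n)) = x (int i - int n)" if "i < 2 * n + 1" for i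
    using occ that unfolding occurs_def by auto
  then show "translate (a - int n) c \<in> cyl w"
    by (simp add: cyl_def translate_def w_def algebra_simps del: upt_Suc)
next
  assume c: "translate (a - int n) c \<in> cyl w"
  show "occurs n x c a" unfolding occurs_def
  proof (intro allI impI)
    fix i assume i: "\<bar>i\<bar> \<le> int n"
    then obtain j where j: "i = int j - int n" "j < 2 * n + 1"
      by (intro that[of "nat (i + int n)"]) auto
    then have "translate (a - int n) c (int j) = x (int j - int n)"
      using c by (simp add: cyl_def w_def del: upt_Suc)
    then show "c (a + i) = x i" by (simp add: j(1) translate_def algebra_simps)
  qed
qed

lemma sets_occurs: "{c. occurs n x c a} \<in> sets M"
proof -
  have "{c. occurs n x c a} = translate (a - int n) -` cyl w"
    by (auto simp: occurs_iff_cyl)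
  then show ?thesis by (simp add: sets_translate_vimage sets_cyl)
qed

definition occurs_within :: "nat \<Rightarrow> (int \<Rightarrow> 'q) set" where
  "occurs_within N = (\<Union>a\<in>{- int N..int N}. {c. occurs n x c a})"

lemma sets_occurs_within: "occurs_within N \<in> sets M"
  unfolding occurs_within_def by (intro sets.finite_UN sets_occurs) auto

text \<open>Having an occurrence somewhere is a shift-invariant event containing the cylinder of
  \<open>w\<close>, which has positive measure. Ergodicity makes its measure 1, and continuity from
  below passes to bounded positions.\<close>

lemma measure_occurs_within: "(\<lambda>N. measure M (occurs_within N)) \<longlonglongrightarrow> 1"
proof -
  let ?E = "\<Union>N. occurs_within N"
  have E: "?E = {c. \<exists>a. occurs n x c a}"
  proof -
    have "a \<in> {- int (nat \<bar>a\<bar>)..int (nat \<bar>a\<bar>)}" for a by auto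
    then show ?thesis unfolding occurs_within_def by blast
  qed
  have sets_E: "?E \<in> sets M" using sets_occurs_within by auto
  have "shift -` ?E = ?E"
  proof -
    have sh: "shift = translate 1" by (simp add: shift_def translate_def fun_eq_iff)
    have "(\<exists>a. occurs n x (translate 1 c) a) \<longleftrightarrow> (\<exists>a. occurs n x c a)" for c
      unfolding occurs_translate by (metis diff_add_cancel)
    then show ?thesis unfolding E sh vimage_def mem_Collect_eq by simp
  qed
  then have "measure M ?E = 0 \<or> measure M ?E = 1"
    using ergodic sets_E by (simp add: shift_ergodic_def)
  moreover have "cyl w \<subseteq> ?E"
  proof
    fix c assume "c \<in> cyl w"
    then have "occurs n x c (int n)" by (simp add: occurs_iff_cyl)
    then show "c \<in> ?E" unfolding E by blast
  qed
  then have "measure M (cyl w) \<le> measure M ?E" by (rule finite_measure_mono) (rule sets_E)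
  moreover have "measure M (cyl w) > 0" using full by (simp add: full_support_def)
  ultimately have "measure M ?E = 1" by linarith
  moreover have "(\<lambda>N. measure M (occurs_within N)) \<longlonglongrightarrow> measure M ?E"
  proof (rule finite_Lim_measure_incseq)
    show "incseq occurs_within" unfolding incseq_def occurs_within_def by fastforce
  qed (use sets_occurs_within in auto)
  ultimately show ?thesis by simp
qed

text \<open>\<open>w\<close> recurs in \<open>y\<close> with period \<open>p\<close>, so two of its
  occurrences enclose the given occurrence of \<open>u\<close>. All members of the cylinder that
  copies \<open>y\<close> across these two imitate \<open>y\<close> in between forever, so its
  measure is a lower bound at every time when \<open>(F ^^ t) y\<close> recurs.\<close>

lemma limit_lang_if_periodic:
  assumes p: "0 < p" and y: "translate (int p) y = y" "y \<in> cyl w" and t: "q ^ p \<le> t"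
    and u: "translate i ((F ^^ t) y) \<in> cyl u"
  shows "u \<in> limit_lang r \<delta> M"
proof -
  \<comment> \<open>\<open>K\<close> periods on either side are enough because
    \<open>p >= 1\<close>; the summand \<open>n\<close> offsets the centre \<open>n\<close> of the
    occurrence that starts at the origin.\<close>
  define K where "K = \<bar>i\<bar> + int (length u) + int n"
  define a where "a = int n + - K * int p"
  define b where "b = int n + K * int p"
  have "K * 1 \<le> K * int p" using p by (intro mult_left_mono) (auto simp: K_def)
  then have "\<bar>i\<bar> + int (length u) + int n \<le> K * int p" by (simp add: K_def)
  moreover have "a = int n - K * int p" by (simp add: a_def)
  ultimately have a_le: "a \<le> i" and b_ge: "i + int (length u) \<le> b"
    unfolding b_def by linarith+
  have "occurs n x y (int n)" using y(2) by (simp add: occurs_iff_cyl)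
  then have occ: "occurs n x y (int n + k * int p)" for k
    using periodic_translate_mult[OF y(1), of k] by (metis occurs_translate)
  \<comment> \<open>This covers the cells \<open>a - n..b + n\<close>, so both occurrences are
    prescribed completely.\<close>
  define v where "v = map (\<lambda>j. y (int j + (a - int n))) [0..<nat (b - a + 2 * int n + 1)]"
  define C where "C = translate (a - int n) -` cyl v"
  have C: "c z = y z" if "c \<in> C" "a - int n \<le> z" "z \<le> b + int n" for c z
  proof -
    define j where "j = nat (z - (a - int n))"
    have j: "z = int j + (a - int n)" "j < nat (b - a + 2 * int n + 1)"
      using that(2,3) by (auto simp: j_def)
    then have "translate (a - int n) c (int j) = y (int j + (a - int n))"
      using that(1) by (simp add: C_def cyl_def v_def)
    then show ?thesis by (simp add: j(1) translate_def)
  qed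
  have "measure M C = measure M (cyl v)"
    unfolding C_def by (rule measure_translate_vimage) (rule sets_cyl)
  then have C_pos: "0 < measure M C" using full by (simp add: full_support_def)
  have bound: "measure M C \<le> measure M ((F ^^ t') -` cyl u)" if t': "(F ^^ t') y = (F ^^ t) y" for t'
  proof -
    have "C \<subseteq> translate i -` ((F ^^ t') -` cyl u)"
    proof
      fix c assume c: "c \<in> C"
      have "occurs n x c k" if "occurs n x y k" "a \<le> k" "k \<le> b" for k
        unfolding occurs_def
      proof (intro allI impI)
        fix i assume i: "\<bar>i\<bar> \<le> int n"
        then have "c (k + i) = y (k + i)" using that by (intro C[OF c]) auto
        then show "c (k + i) = x i" using that(1) i by (simp add: occurs_def)
      qed
      moreover have "a \<le> b" using a_le b_ge by linarith
      ultimately have occ_c: "occurs n x c a" "occurs n x c b"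
        using occ[of "- K"] occ[of K] by (auto simp: a_def b_def)
      have "(F ^^ t') c z = (F ^^ t') y z" if "a \<le> z" "z \<le> b" for z
        using that C[OF c] occ[of "- K"] occ[of K]
        by (intro blocking_between[OF x occ_c]) (auto simp: a_def b_def)
      then have "translate i ((F ^^ t') c) (int j) = translate i ((F ^^ t) y) (int j)"
        if "j < length u" for j
        using that a_le b_ge t' by (simp add: translate_def)
      then have "translate i ((F ^^ t') c) \<in> cyl u" using u by (simp add: cyl_def)
      then show "c \<in> translate i -` ((F ^^ t') -` cyl u)" by (simp add: ca_global_pow_translate)
    qed
    then have "measure M C \<le> measure M (translate i -` ((F ^^ t') -` cyl u))"
      by (rule finite_measure_mono) (intro sets_translate_vimage sets_F_pow_vimage)
    then show ?thesis by (simp add: measure_translate_vimage sets_F_pow_vimage)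
  qed
  have "\<forall>T. \<exists>t'\<ge>T. measure M C \<le> measure M ((F ^^ t') -` cyl u)"
    using periodic_recurrence[OF p y(1) t] bound by blast
  then show ?thesis unfolding limit_lang_iff_frequently using C_pos by blast
qed

text \<open>An event of measure at least \<open>\<epsilon>\<close> must meet the event that two
  occurrences enclose the window of \<open>u\<close>, as the latter fails with probability below
  \<open>\<epsilon>\<close>. A block of a common point around the window, repeated periodically,
  still evolves like that point inside the window.\<close>

lemma periodic_if_limit_lang:
  assumes "u \<in> limit_lang r \<delta> M"
  obtains p y t i where "0 < p" "translate (int p) y = y" "y \<in> cyl w" "q ^ p \<le> t"
    "translate i ((F ^^ t) y) \<in> cyl u"
proof -
  obtain \<epsilon> where \<epsilon>: "0 < \<epsilon>" "\<And>T. \<exists>t\<ge>T. \<epsilon> \<le> measure M ((F ^^ t) -` cyl u)"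
    using assms unfolding limit_lang_iff_frequently by blast
  have "\<forall>\<^sub>F N in sequentially. 1 - \<epsilon> / 2 < measure M (occurs_within N)"
    using measure_occurs_within \<epsilon>(1) by (intro order_tendstoD) auto
  then obtain N where N: "1 - \<epsilon> / 2 < measure M (occurs_within N)"
    by (auto simp: eventually_sequentially)
  define l where "l = length u"
  \<comment> \<open>The occurrences will be centred in \<open>-2N..2N + l\<close> and reach
    \<open>n\<close> cells further, so the block \<open>-m..m\<close> contains them.\<close>
  define m where "m = 2 * N + l + n"
  define p where "p = 2 * m + 1"
  obtain t where t: "q ^ p \<le> t" "\<epsilon> \<le> measure M ((F ^^ t) -` cyl u)" using \<epsilon>(2) by blast
  define A where "A = (F ^^ t) -` cyl u"
  \<comment> \<open>\<open>B1\<close> asks for an occurrence centred in \<open>-2N..0\<close>,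
    \<open>B2\<close> for one in \<open>l..2N + l\<close>: on either side of the window
    \<open>0..l - 1\<close>.\<close>
  define B1 where "B1 = translate (- int N) -` occurs_within N"
  define B2 where "B2 = translate (int N + int l) -` occurs_within N"
  have sets: "A \<in> sets M" "B1 \<in> sets M" "B2 \<in> sets M"
    unfolding A_def B1_def B2_def
    by (intro sets_F_pow_vimage sets_translate_vimage sets_occurs_within)+
  have B: "measure M B1 = measure M (occurs_within N)" "measure M B2 = measure M (occurs_within N)"
    unfolding B1_def B2_def by (simp_all add: measure_translate_vimage sets_occurs_within)
  have "A \<inter> B1 \<inter> B2 \<noteq> {}"
  proof
    assume empty: "A \<inter> B1 \<inter> B2 = {}"
    have "measure M A \<le> measure M ((space M - B1) \<union> (space M - B2))"
    proof (rule finite_measure_mono)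
      show "A \<subseteq> (space M - B1) \<union> (space M - B2)" using empty by (auto simp: space_M)
    qed (use sets in auto)
    also have "\<dots> \<le> measure M (space M - B1) + measure M (space M - B2)"
      using sets by (intro measure_Un_le) auto
    also have "\<dots> = (1 - measure M B1) + (1 - measure M B2)"
      using sets by (simp add: prob_compl)
    also have "\<dots> < \<epsilon>" using N B by linarith
    finally show False using t(2) by (simp add: A_def)
  qed
  then obtain c where c: "(F ^^ t) c \<in> cyl u" "c \<in> B1" "c \<in> B2" by (auto simp: A_def)
  obtain a where a: "occurs n x c a" "- 2 * int N \<le> a" "a \<le> 0"
  proof -
    obtain a' where "a' \<in> {- int N..int N}" "occurs n x (translate (- int N) c) a'"
      using c(2) unfolding B1_def occurs_within_def by blast
    then show ?thesis by (intro that[of "a' + - int N"]) (auto simp: occurs_translate)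
  qed
  obtain b where b: "occurs n x c b" "int l \<le> b" "b \<le> 2 * int N + int l"
  proof -
    obtain b' where "b' \<in> {- int N..int N}" "occurs n x (translate (int N + int l) c) b'"
      using c(3) unfolding B2_def occurs_within_def by blast
    then show ?thesis by (intro that[of "b' + (int N + int l)"]) (auto simp: occurs_translate)
  qed
  \<comment> \<open>Adding \<open>m\<close> before \<open>mod\<close> and removing it afterwards
    selects representatives in \<open>-m..m\<close>, so \<open>y\<close> repeats the block of
    \<open>c\<close> on these cells.\<close>
  define y where "y z = c ((z + int m) mod int p - int m)" for z
  have y_periodic: "translate (int p) y = y"
  proof -
    have "(z + int p + int m) mod int p = (z + int m) mod int p" for z
      by (metis add.assoc add.commute mod_add_self2)
    then show ?thesis by (simp add: translate_def y_def fun_eq_iff)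
  qed
  have y_eq: "y z = c z" if "- int m \<le> z" "z \<le> int m" for z
    using that by (simp add: y_def p_def)
  have occ_y: "occurs n x y k" if "occurs n x c k" "- 2 * int N \<le> k" "k \<le> 2 * int N + int l" for k
    unfolding occurs_def
  proof (intro allI impI)
    fix i assume i: "\<bar>i\<bar> \<le> int n"
    then have "y (k + i) = c (k + i)" using that by (intro y_eq) (auto simp: m_def)
    then show "y (k + i) = x i" using that(1) i by (simp add: occurs_def)
  qed
  have "(F ^^ t) y z = (F ^^ t) c z" if "a \<le> z" "z \<le> b" for z
  proof (rule blocking_between[OF x _ _ a(1) b(1) _ that])
    show "occurs n x y a" "occurs n x y b" using a b by (auto intro!: occ_y)
  qed (use a b in \<open>auto intro!: y_eq simp: m_def\<close>)
  then have u: "(F ^^ t) y \<in> cyl u" using c(1) a b by (auto simp: cyl_def l_def)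
  show ?thesis
  proof (rule that)
    show "0 < p" by (simp add: p_def)
    \<comment> \<open>Translating by \<open>a - n\<close> puts the left occurrence of
      \<open>w\<close> at the origin.\<close>
    show "translate (int p) (translate (a - int n) y) = translate (a - int n) y"
      by (metis y_periodic translate_translate add.commute)
    show "translate (a - int n) y \<in> cyl w"
      using occ_y[OF a(1)] a b unfolding occurs_iff_cyl by auto
    show "translate (int n - a) ((F ^^ t) (translate (a - int n) y)) \<in> cyl u"
      using u by (simp add: ca_global_pow_translate translate_translate)
  qed (rule t(1))
qed

text \<open>A witness is a periodic configuration (\<open>p\<close>, \<open>m\<close>), a time
  \<open>t\<close>, a position \<open>i\<close>, a word (\<open>l\<close>, \<open>k\<close>) and a
  number \<open>K\<close> of periods, enough for the unrolled segment to contain the light cone of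
  the word. The blocking word enters through the constants \<open>lw\<close> and \<open>W\<close>,
  so its mere existence gives decidability.\<close>

lemma rec_enum_limit_lang_aux: "rec_enum (word_code enc ` limit_lang r \<delta> M)"
proof -
  define lw where "lw = length w"
  obtain W where W: "word lw W = w" using ex_word unfolding lw_def by blast
  define unroll where "unroll p m K = (\<Sum>z<K * p. dig q m (z mod p) * q ^ z)" for p m K
  define P where "P s p m K t i l k \<longleftrightarrow> s = digits_code q l k \<and> 0 < p \<and> q ^ p \<le> t \<and>
      lw + i + l + 2 * r * t \<le> K * p \<and> unroll p m K mod q ^ lw = W mod q ^ lw \<and>
      (step (K * p) ^^ t) (unroll p m K) div q ^ i mod q ^ l = k mod q ^ l" for s p m K t i l k
  define R where "R xs = P (xs ! 0) (component 0 (xs ! 1)) (component 1 (xs ! 1))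
      (component 2 (xs ! 1)) (component 3 (xs ! 1)) (component 4 (xs ! 1)) (component 5 (xs ! 1))
      (component 6 (xs ! 1))" for xs
  have comp_unroll: "computable_fun k (\<lambda>xs. unroll (f xs) (g xs) (h xs))"
    if fgh: "computable_fun k f" "computable_fun k g" "computable_fun k h" for k f g h
  proof (rule computable_comp3[OF _ fgh])
    show "computable_fun 3 (\<lambda>xs. unroll (xs ! 0) (xs ! 1) (xs ! 2))"
      unfolding unroll_def by (intro computable_arith computable_dig computable_mod) auto
  qed
  have "decidable_rel 2 R"
    unfolding R_def P_def
    by (intro computable_arith computable_div computable_mod computable_digits_code
        computable_step_pow comp_unroll computable_component) auto
  moreover have "word_code enc ` limit_lang r \<delta> M = {s. \<exists>a. R [s, a]}"
  proof -
    have conf_unroll: "periodic_conf p m z = conf (unroll p m K) z"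
      if "0 \<le> z" "z < int (K * p)" for p m K z
    proof -
      have "nat z < K * p" using that by linarith
      then have "dig q (unroll p m K) (nat z) = dig q m (nat z mod p)"
        unfolding unroll_def by (intro dig_sum dig_less q_pos)
      moreover have "nat (z mod int p) = nat z mod p" using that(1) by (simp add: nat_mod_distrib)
      ultimately show ?thesis by (simp add: periodic_conf_def conf_def)
    qed
    have P_iff: "P s p m K t i l k \<longleftrightarrow> s = word_code enc (word l k) \<and> 0 < p \<and> q ^ p \<le> t \<and>
        lw + i + l + 2 * r * t \<le> K * p \<and> periodic_conf p m \<in> cyl w \<and>
        translate (int i) ((G ^^ t) (periodic_conf p m)) \<in> cyl (word l k)" for s p m K t i l k
    proof (cases "lw + i + l + 2 * r * t \<le> K * p")
      case True
      have "unroll p m K mod q ^ lw = W mod q ^ lw \<longleftrightarrow> periodic_conf p m \<in> cyl w"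
        using step_pow_mod_eq_iff[of "K * p" "periodic_conf p m" "unroll p m K" 0 lw 0 W]
          conf_unroll True W by simp
      moreover have "(step (K * p) ^^ t) (unroll p m K) div q ^ i mod q ^ l = k mod q ^ l \<longleftrightarrow>
          translate (int i) ((G ^^ t) (periodic_conf p m)) \<in> cyl (word l k)"
        using conf_unroll True by (intro step_pow_mod_eq_iff) auto
      ultimately show ?thesis unfolding P_def word_code_word by blast
    qed (simp add: P_def)
    have R_iff: "(\<exists>a. R [s, a]) \<longleftrightarrow> (\<exists>p m K t i l k. P s p m K t i l k)" for s
    proof
      assume "\<exists>p m K t i l k. P s p m K t i l k"
      then obtain p m K t i l k where P: "P s p m K t i l k" by blast
      obtain c where c: "\<forall>j<length [p, m, K, t, i, l, k]. component j c = [p, m, K, t, i, l, k] ! j"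
        using ex_components by blast
      have "component 0 c = p" "component 1 c = m" "component 2 c = K" "component 3 c = t"
        "component 4 c = i" "component 5 c = l" "component 6 c = k"
        using c[rule_format, of 0] c[rule_format, of 1] c[rule_format, of 2] c[rule_format, of 3]
          c[rule_format, of 4] c[rule_format, of 5] c[rule_format, of 6] by auto
      then have "R [s, c]" using P by (simp add: R_def)
      then show "\<exists>a. R [s, a]" by blast
    next
      assume "\<exists>a. R [s, a]"
      then obtain a where "R [s, a]" by blast
      then show "\<exists>p m K t i l k. P s p m K t i l k" unfolding R_def nth_Cons_0 by (intro exI)
    qed
    have iff: "s \<in> word_code enc ` limit_lang r \<delta> M \<longleftrightarrow> (\<exists>p m K t i l k. P s p m K t i l k)" for s
    proof
      assume "s \<in> word_code enc ` limit_lang r \<delta> M"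
      then obtain u where u: "u \<in> limit_lang r \<delta> M" "s = word_code enc u" by blast
      obtain k where k: "word (length u) k = u" using ex_word by blast
      obtain p y t j where y: "0 < p" "translate (int p) y = y" "y \<in> cyl w" "q ^ p \<le> t"
        "translate j ((F ^^ t) y) \<in> cyl u" using periodic_if_limit_lang[OF u(1)] .
      obtain m where m: "y = periodic_conf p m" using ex_periodic_conf[OF y(1,2)] by blast
      \<comment> \<open>\<open>G ^^ t\<close> is \<open>F ^^ t\<close> translated by
        \<open>r * t\<close>, which is subtracted here; reduction modulo the period then makes the
        position a natural number.\<close>
      define j' where "j' = j - int (r * t)"
      define i where "i = nat (j' mod int p)"
      have "translate (int p) ((G ^^ t) y) = (G ^^ t) y"
        unfolding ca_onesided_pow
        by (metis translate_translate add.commute periodic_ca_global_pow[OF y(2)])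
      from periodic_translate_mult[OF this, of "j' div int p"]
      have "translate (int i) ((G ^^ t) y) = translate (int i) (translate (j' div int p * int p) ((G ^^ t) y))"
        by simp
      also have "\<dots> = translate j' ((G ^^ t) y)"
        using y(1) by (simp add: translate_translate i_def)
      also have "\<dots> = translate j ((F ^^ t) y)"
        by (simp add: ca_onesided_pow translate_translate j'_def)
      finally have "translate (int i) ((G ^^ t) y) \<in> cyl u" using y(5) by simp
      \<comment> \<open>This is the required number of cells; since \<open>p >= 1\<close>, as many
        periods provide at least that many cells.\<close>
      moreover define K where "K = lw + i + length u + 2 * r * t"
      have "K \<le> K * p" using y(1) by simp
      ultimately have "P s p m K t i (length u) k"
        unfolding P_iff k using u(2) y m by (simp add: K_def)
      then show "\<exists>p m K t i l k. P s p m K t i l k" by blast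
    next
      assume "\<exists>p m K t i l k. P s p m K t i l k"
      then obtain p m K t i l k where P: "P s p m K t i l k" by blast
      then have "translate (int i + int (r * t)) ((F ^^ t) (periodic_conf p m)) \<in> cyl (word l k)"
        unfolding P_iff by (simp add: ca_onesided_pow translate_translate)
      then have "word l k \<in> limit_lang r \<delta> M"
        using P unfolding P_iff by (intro limit_lang_if_periodic[OF _ periodic_periodic_conf]) auto
      then show "s \<in> word_code enc ` limit_lang r \<delta> M" using P unfolding P_iff by blast
    qed
    show ?thesis by (rule set_eqI) (unfold mem_Collect_eq iff R_iff, rule refl)
  qed
  ultimately show ?thesis unfolding rec_enum_def by blast
qed

end

lemma rec_enum_limit_lang:
  assumes "shift_ergodic M" "full_support M" "equicont_point r \<delta> x"
  shows "rec_enum (word_code enc ` limit_lang r \<delta> M)"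
proof -
  obtain n where "blocking r \<delta> n x" using equicont_point_blocking[OF assms(3)] by blast
  then show ?thesis by (rule rec_enum_limit_lang_aux[OF assms(1,2)])
qed

end

theorem theorem3:
  fixes r :: nat and \<delta> :: "'q::finite list \<Rightarrow> 'q"
    and \<mu> :: "(int \<Rightarrow> 'q) measure" and enc :: "'q \<Rightarrow> nat"
  assumes "bij_betw enc UNIV {..<CARD('q)}"
    and "prob_space \<mu>"
    and "sets \<mu> = sets conf_space"
    and "shift_invariant \<mu>"
  shows "(computable_measure enc \<mu> \<longrightarrow> Sigma3 (word_code enc ` limit_lang r \<delta> \<mu>))
    \<and> (shift_ergodic \<mu> \<and> full_support \<mu> \<and> (\<exists>x. equicont_point r \<delta> x)
         \<longrightarrow> rec_enum (word_code enc ` limit_lang r \<delta> \<mu>))"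
proof -
  interpret automaton_measure r \<delta> enc "CARD('q)" \<mu>
    using assms by (simp add: automaton_measure_def automaton_measure_axioms_def coded_automaton_def)
  show ?thesis by (auto intro: Sigma3_limit_lang rec_enum_limit_lang)
qed

end
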